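(* Fix an integer $k\ge 2$ and a permutation $\alpha=\alpha_1\ldots\alpha_k$ of length $k$. For $n$ of the form $n=2^{m+1}-1$, let $T_n$ be the complete binary tree with $n$ nodes, and let $\varkappa_r=\varkappa_r(R(\alpha,T_n))$ be the $r$-th cumulant of the random variable $R(\alpha,T_n)$. Then for every fixed $r\ge 2$ there exists a constant $D_{\alpha,r}$, depending only on $\alpha$ and $r$, such that, as $n\to\infty$, $$\varkappa_r = D_{\alpha,r}\,\Upsilon_r^k(T_n)+o\big(\Upsilon_r^k(T_n)\big).$$
   Context: The complete binary tree of height $m$ has $n=2^{m+1}-1$ nodes; it is rooted, and the nodes are partially ordered by $a<b$ if $a$ is a (proper) ancestor of $b$. Let $V$ be the node set of a rooted tree $T$ with $n$ nodes and let $\pi:V\to[n]$ be a labelling (bijection) chosen uniformly at random among all $n!$ labellings. For nodes $u_1<\dots<u_k$ write $\pi(u)=(\pi(u_1),\dots,\pi(u_k))$, and write $\pi(u)\approx\alpha$ if the sequence $\pi(u)$ has the same relative order as $\alpha_1\ldots\alpha_k$. Define $$R(\alpha,T)=\sum_{u_1<\dots<u_k}\mathbf 1[\pi(u)\approx\alpha],$$ the sum being over all chains $u_1<\dots<u_k$ of nodes. Let $d(v)$ be the depth of $v$ (distance to the root). For nodes $v_1,\dots,v_r$ let $c(v_1,\dots,v_r)=|\{u\in V: u\le v_1,\ u\le v_2,\dots,u\le v_r\}|$ be the number of common ancestors (a node counts as an ancestor of itself here). Define $$\Upsilon_r^k(T)=\sum_{v_1,\dots,v_r} c(v_1,\dots,v_r)\prod_{i=1}^r\binom{d(v_i)}{k-2},$$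 the sum being over all ordered $r$-tuples of nodes, with $\binom{x}{0}=1$. The cumulants $\varkappa_r(X)$ of a random variable $X$ are defined by $\log \mathbb E(e^{\xi X})=\sum_r \varkappa_r(X)\,\xi^r/r!$. *)

theory Defs
  imports
    "HOL-Probability.Probability"
    "HOL-Library.Sublist"
    "HOL-Library.Landau_Symbols"
begin

text \<open>
  A finite rooted tree is represented by a finite, nonempty, prefix-closed set of lists: a node is
  the list of directions on the path from the root to it.  The root is the empty list, the
  distance of a node to the root is its length, and the ancestors of a node are its prefixes.
\<close>

definition rooted_tree :: "'a list set \<Rightarrow> bool" where
  "rooted_tree T \<longleftrightarrow> finite T \<and> [] \<in> T \<and> (\<forall>v\<in>T. \<forall>u. prefix u v \<longrightarrow> u \<in> T)"

definition depth :: "'a list \<Rightarrow> nat" where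
  "depth v = length v"

definition complete_binary_tree :: "nat \<Rightarrow> bool list set" where
  "complete_binary_tree m = {v. length v \<le> m}"

lemma rooted_tree_complete_binary_tree: "rooted_tree (complete_binary_tree m)"
proof -
  have "finite (complete_binary_tree m)"
    using finite_lists_length_le[of "UNIV :: bool set" m]
    by (simp add: complete_binary_tree_def)
  then show ?thesis
    by (auto simp: rooted_tree_def complete_binary_tree_def dest: prefix_length_le)
qed

lemma card_complete_binary_tree: "card (complete_binary_tree m) = 2 ^ (m + 1) - 1"
proof -
  have "card (complete_binary_tree m) = (\<Sum>i\<le>m. 2 ^ i)"
    using card_lists_length_le[of "UNIV :: bool set" m]
    by (simp add: complete_binary_tree_def)
  also have "\<dots> = 2 ^ (m + 1) - 1"
    using mask_eq_sum_exp_nat[of "m + 1"] by (simp add: lessThan_Suc_atMost[symmetric] lessThan_def)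
  finally show ?thesis .
qed

text \<open>Labellings are made extensional so that there are exactly \<open>fact (card T)\<close> of them.\<close>

definition labellings :: "'a list set \<Rightarrow> ('a list \<Rightarrow> nat) set" where
  "labellings T = {\<pi> \<in> T \<rightarrow>\<^sub>E {1..card T}. bij_betw \<pi> T {1..card T}}"

lemma finite_labellings: "finite T \<Longrightarrow> finite (labellings T)"
  unfolding labellings_def
  by (rule finite_subset[OF _ finite_PiE[of T "\<lambda>_. {1..card T}"]]) auto

lemma labellings_nonempty:
  assumes "finite T"
  shows "labellings T \<noteq> {}"
proof -
  obtain f where f: "bij_betw f T {1..card T}"
    using assms finite_same_card_bij[of T "{1..card T}"] by auto
  then have "bij_betw (restrict f T) T {1..card T}"
    by (simp cong: bij_betw_cong)
  then have "restrict f T \<in> labellings T"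
    by (auto simp: labellings_def dest: bij_betwE)
  then show ?thesis by blast
qed

definition random_labelling :: "'a list set \<Rightarrow> ('a list \<Rightarrow> nat) pmf" where
  "random_labelling T = pmf_of_set (labellings T)"

definition same_relative_order :: "nat list \<Rightarrow> nat list \<Rightarrow> bool" where
  "same_relative_order xs ys \<longleftrightarrow>
     length xs = length ys \<and>
     (\<forall>i<length xs. \<forall>j<length xs. xs ! i < xs ! j \<longleftrightarrow> ys ! i < ys ! j)"

definition chains :: "nat \<Rightarrow> 'a list set \<Rightarrow> 'a list list set" where
  "chains k T = {us. length us = k \<and> set us \<subseteq> T \<and> sorted_wrt strict_prefix us}"

definition pattern_count :: "nat list \<Rightarrow> 'a list set \<Rightarrow> ('a list \<Rightarrow> nat) \<Rightarrow> real" where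
  "pattern_count \<alpha> T \<pi> =
     (\<Sum>us\<in>chains (length \<alpha>) T. of_bool (same_relative_order (map \<pi> us) \<alpha>))"

definition common_ancestors :: "'a list set \<Rightarrow> 'a list list \<Rightarrow> nat" where
  "common_ancestors T vs = card {u \<in> T. \<forall>v\<in>set vs. prefix u v}"

definition Upsilon :: "nat \<Rightarrow> nat \<Rightarrow> 'a list set \<Rightarrow> nat" where
  "Upsilon r k T =
     (\<Sum>vs | length vs = r \<and> set vs \<subseteq> T.
        common_ancestors T vs * (\<Prod>i<r. depth (vs ! i) choose (k - 2)))"

text \<open>
  The cumulants are \<open>fact r\<close> times the coefficients of the power series that agrees with the
  cumulant generating function near \<open>0\<close>.  This is meaningful only if the moment generating function
  is finite near \<open>0\<close>; for finitely supported distributions the power series exists and is unique,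
  see below.
\<close>

definition cumulant :: "'b measure \<Rightarrow> ('b \<Rightarrow> real) \<Rightarrow> nat \<Rightarrow> real" where
  "cumulant M X r =
     fact r * fps_nth (THE F. (\<lambda>\<xi>. ln (\<integral>\<omega>. exp (\<xi> * X \<omega>) \<partial>M)) has_fps_expansion F) r"

lemma real_fps_expansion_unique:
  fixes f :: "real \<Rightarrow> real"
  assumes "f has_fps_expansion F" "f has_fps_expansion G"
  shows "F = G"
proof -
  have "fps_nth F n = fps_nth G n" for n
    using assms
  proof (induction n arbitrary: f F G)
    case 0
    then have "eval_fps F 0 = f 0" "eval_fps G 0 = f 0"
      by (auto simp: has_fps_expansion_def dest: eventually_nhds_x_imp_x)
    then show ?case by (simp add: eval_fps_at_0)
  next
    case (Suc n)
    have "fps_nth (fps_deriv F) n = fps_nth (fps_deriv G) n"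
      using Suc.prems by (intro Suc.IH[of "deriv f"] has_fps_expansion_deriv)
    then show ?case by (simp del: of_nat_Suc)
  qed
  then show ?thesis by (simp add: fps_eq_iff)
qed

lemma fps_conv_radius_integral0_pos:
  fixes G :: "real fps"
  assumes "fps_conv_radius G > 0"
  shows "fps_conv_radius (fps_integral0 G) > 0"
proof -
  have "0 < fps_conv_radius (fps_X * G)"
    using assms fps_conv_radius_mult[of "fps_X :: real fps" G] by simp
  also have "\<dots> \<le> fps_conv_radius (fps_integral0 G)"
    unfolding fps_conv_radius_def
  proof (rule conv_radius_geI_ex)
    fix x :: real
    assume x: "0 < x" "ereal x < conv_radius (fps_nth (fps_X * G))"
    have le: "norm (fps_nth (fps_integral0 G) n) \<le> norm (fps_nth (fps_X * G) n)" for n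
    proof (cases n)
      case (Suc k)
      have "\<bar>fps_nth G k\<bar> * 1 \<le> \<bar>fps_nth G k\<bar> * (1 + real k)"
        by (intro mult_left_mono) auto
      then show ?thesis
        by (simp add: Suc fps_integral_def divide_simps abs_mult mult_ac)
    qed (simp add: fps_integral_def)
    have "summable (\<lambda>n. norm (fps_nth (fps_X * G) n * x ^ n))"
      using x by (intro abs_summable_in_conv_radius) simp
    moreover have "norm (fps_nth (fps_integral0 G) n * x ^ n) \<le> norm (fps_nth (fps_X * G) n * x ^ n)" for n
      unfolding norm_mult by (intro mult_right_mono le norm_ge_zero)
    ultimately have "summable (\<lambda>n. fps_nth (fps_integral0 G) n * x ^ n)"
      by (rule summable_comparison_test'[where N = 0])
    then show "\<exists>z. norm z = x \<and> summable (\<lambda>n. fps_nth (fps_integral0 G) n * z ^ n)"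
      using x(1) by (intro exI[of _ x]) simp
  qed
  finally show ?thesis .
qed

lemma cumulant_generating_function_has_fps_expansion:
  fixes p :: "'b pmf" and X :: "'b \<Rightarrow> real"
  assumes "finite (set_pmf p)"
  shows "\<exists>!F. (\<lambda>\<xi>. ln (\<integral>\<omega>. exp (\<xi> * X \<omega>) \<partial>measure_pmf p)) has_fps_expansion F"
proof -
  define \<phi> where "\<phi> = (\<lambda>\<xi>. \<integral>\<omega>. exp (\<xi> * X \<omega>) \<partial>measure_pmf p)"
  have \<phi>: "\<phi> = (\<lambda>\<xi>. \<Sum>\<omega>\<in>set_pmf p. pmf p \<omega> * exp (X \<omega> * \<xi>))"
    using assms unfolding \<phi>_def
    by (intro ext, subst integral_measure_pmf_real[OF assms]) (auto simp: mult_ac)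
  have pos: "\<phi> \<xi> > 0" for \<xi>
    unfolding \<phi> using assms set_pmf_not_empty[of p] by (intro sum_pos) (auto simp: pmf_positive)
  define \<Phi> where "\<Phi> = (\<Sum>\<omega>\<in>set_pmf p. fps_const (pmf p \<omega>) * fps_exp (X \<omega>))"
  have exp\<phi>: "\<phi> has_fps_expansion \<Phi>"
    unfolding \<phi> \<Phi>_def by (intro fps_expansion_intros)
  have nz: "fps_nth \<Phi> 0 \<noteq> 0"
  proof -
    have "eval_fps \<Phi> 0 = \<phi> 0"
      using exp\<phi> by (auto simp: has_fps_expansion_def dest: eventually_nhds_x_imp_x)
    then show ?thesis using pos[of 0] by (simp add: eval_fps_at_0)
  qed
  define G where "G = fps_deriv \<Phi> / \<Phi>"
  have expG: "(\<lambda>\<xi>. deriv \<phi> \<xi> / \<phi> \<xi>) has_fps_expansion G"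
    unfolding G_def using exp\<phi> nz by (intro has_fps_expansion_divide' has_fps_expansion_deriv)
  define L where "L = fps_integral0 G"
  have L: "fps_conv_radius L > 0"
    unfolding L_def using expG by (intro fps_conv_radius_integral0_pos) (simp add: has_fps_expansion_def)
  have "eventually (\<lambda>\<xi>. \<xi> \<in> eball 0 (fps_conv_radius L) \<and> eval_fps G \<xi> = deriv \<phi> \<xi> / \<phi> \<xi>) (nhds 0)"
    using L expG by (intro eventually_conj eventually_nhds_in_open)
      (auto simp: has_fps_expansion_def zero_ereal_def)
  then obtain e where e: "e > 0"
    "\<And>\<xi>. \<bar>\<xi>\<bar> < e \<Longrightarrow> ereal (norm \<xi>) < fps_conv_radius L"
    "\<And>\<xi>. \<bar>\<xi>\<bar> < e \<Longrightarrow> eval_fps G \<xi> = deriv \<phi> \<xi> / \<phi> \<xi>"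
    by (auto simp: eventually_nhds_metric in_eball_iff dist_real_def)
  have "\<exists>c. \<forall>\<xi>\<in>ball 0 e. ln (\<phi> \<xi>) - eval_fps L \<xi> = c"
  proof (rule has_field_derivative_zero_constant)
    fix \<xi> :: real assume \<xi>: "\<xi> \<in> ball 0 e"
    have "\<phi> field_differentiable at \<xi>"
      unfolding \<phi> field_differentiable_def by (rule exI) (auto intro!: derivative_eq_intros)
    then have "(\<phi> has_field_derivative deriv \<phi> \<xi>) (at \<xi> within ball 0 e)"
      by (intro DERIV_subset[OF DERIV_deriv_iff_field_differentiable[THEN iffD2]]) auto
    moreover have "(eval_fps L has_field_derivative eval_fps (fps_deriv L) \<xi>) (at \<xi> within ball 0 e)"
      using \<xi> e(2) by (intro has_field_derivative_eval_fps) auto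
    moreover have "eval_fps (fps_deriv L) \<xi> = deriv \<phi> \<xi> / \<phi> \<xi>"
      using e(3)[of \<xi>] \<xi> by (simp add: L_def fps_deriv_fps_integral)
    ultimately show "((\<lambda>\<xi>. ln (\<phi> \<xi>) - eval_fps L \<xi>) has_field_derivative 0) (at \<xi> within ball 0 e)"
      using pos[of \<xi>] by (auto intro!: derivative_eq_intros)
  qed auto
  then obtain c where c: "\<And>\<xi>. \<xi> \<in> ball 0 e \<Longrightarrow> ln (\<phi> \<xi>) = c + eval_fps L \<xi>"
    by (metis add.commute diff_add_cancel)
  have "(\<lambda>\<xi>. c + eval_fps L \<xi>) has_fps_expansion fps_const c + L"
    using L by (intro fps_expansion_intros eval_fps_has_fps_expansion)
  moreover have "eventually (\<lambda>\<xi>. ln (\<phi> \<xi>) = c + eval_fps L \<xi>) (nhds 0)"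
    using e(1) c by (auto intro!: eventually_mono[OF eventually_nhds_in_open[of "ball 0 e" 0]])
  ultimately have "(\<lambda>\<xi>. ln (\<phi> \<xi>)) has_fps_expansion fps_const c + L"
    by (auto simp: has_fps_expansion_def elim: eventually_elim2)
  then show ?thesis
    unfolding \<phi>_def using real_fps_expansion_unique by blast
qed

end

theory Submission
  imports Defs
begin

text \<open>
  Let \<open>s\<close> be the sum of \<open>d(v) choose (k - 2)\<close> over all nodes \<open>v\<close>.  The number of chains starting at
  a fixed node of depth \<open>j\<close> is asymptotically \<open>s / 2^j\<close>, and \<open>\<Upsilon>\<close> is asymptotically a positive
  constant times \<open>s^r\<close>.  Hence it suffices that all cumulants, equivalently all moments, of
  \<open>(R - E R) / s\<close> converge.

  Replace the labelling by independent uniform labels, and fix the labels of the nodes of depth at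
  most \<open>J\<close>.  By the bounded difference inequality the remaining labels contribute little to \<open>R / s\<close>
  if \<open>J\<close> is large, because changing the label of a node of depth \<open>j\<close> changes \<open>R / s\<close> by at most
  \<open>(j + 1) / 2^j\<close>, and these bounds are square summable over the tree.  Almost all chains that meet
  the top levels do so in their first node only, so the conditional expectation of \<open>(R - E R) / s\<close>
  is close to the sum of \<open>f(U\<^sub>u) / 2^d(u)\<close> over the top nodes \<open>u\<close>, where \<open>f\<close> is the centred
  probability of the pattern given the label of the first node.  The law of this sum does not depend
  on the size of the tree, so the moments form Cauchy sequences.
\<close>

section \<open>Cumulants and moments\<close>

text \<open>The labels of a uniformly random labelling are dependent, whereas the bounded difference
  inequality and the conditioning on the top labels both rest on Fubini for a product measure; this
  is why independent labels are introduced. Closeness in mean square alone does not control moments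
  of higher order, so the bounded difference inequality is proved in exponential form, which bounds
  every absolute moment uniformly in \<open>m\<close>.

  The condition \<open>r \<ge> 2\<close> enters twice: such cumulants ignore the shift by the mean,
  and level \<open>j\<close> contributes about \<open>2^j * (s / 2^j)^r\<close> to \<Upsilon>, which
  is summable over \<open>j\<close> relative to \<open>s^r\<close>. For \<open>r = 1\<close> all
  fixed levels would contribute equally in the limit.

  The factor \<open>j + 1\<close> in the influence of a node of depth \<open>j\<close> has two
  sources: chains ending strictly below the node give 1, chains ending at the node give at most
  \<open>j\<close>. The limiting cumulants are not computed; the constant is a quotient of two
  limits whose existence alone is shown.\<close>

definition moment_series :: "'b measure \<Rightarrow> ('b \<Rightarrow> real) \<Rightarrow> real fps" where
  "moment_series M X = Abs_fps (\<lambda>n. (\<integral>\<omega>. X \<omega> ^ n \<partial>M) / fact n)"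

lemma moment_series_pmf:
  assumes "finite (set_pmf p)"
  shows "moment_series (measure_pmf p) X =
    (\<Sum>\<omega>\<in>set_pmf p. fps_const (pmf p \<omega>) * fps_exp (X \<omega>))"
  by (rule fps_ext)
    (simp add: moment_series_def integral_measure_pmf_real[OF assms] fps_sum_nth sum_divide_distrib
      mult.commute)

lemma moment_series_nth_0: "fps_nth (moment_series (measure_pmf p) X) 0 = 1"
  by (simp add: moment_series_def)

text \<open>The logarithm is encoded by its logarithmic derivative,
  \<open>L' * \<Phi> = \<Phi>'\<close> for the moment series \<Phi>. This determines all
  coefficients of \<open>L\<close> of positive index and replaces composition with a formal
  logarithm by a linear equation.\<close>

lemma cumulant_series:
  assumes fin: "finite (set_pmf p)"
  shows "\<exists>L. fps_deriv L * moment_series (measure_pmf p) X = fps_deriv (moment_series (measure_pmf p) X)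
    \<and> (\<forall>r. cumulant (measure_pmf p) X r = fact r * fps_nth L r)"
proof -
  define \<phi> where "\<phi> = (\<lambda>\<xi>. \<integral>\<omega>. exp (\<xi> * X \<omega>) \<partial>measure_pmf p)"
  define \<Phi> where "\<Phi> = moment_series (measure_pmf p) X"
  have \<phi>: "\<phi> = (\<lambda>\<xi>. \<Sum>\<omega>\<in>set_pmf p. pmf p \<omega> * exp (X \<omega> * \<xi>))"
    unfolding \<phi>_def
    by (intro ext, subst integral_measure_pmf_real[OF fin]) (auto simp: mult_ac)
  have pos: "\<phi> \<xi> > 0" for \<xi>
    unfolding \<phi> using fin set_pmf_not_empty[of p] by (intro sum_pos) (auto simp: pmf_positive)
  have exp\<phi>: "\<phi> has_fps_expansion \<Phi>"
    unfolding \<phi> \<Phi>_def moment_series_pmf[OF fin] by (intro fps_expansion_intros)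
  obtain L where L: "(\<lambda>\<xi>. ln (\<phi> \<xi>)) has_fps_expansion L"
    using cumulant_generating_function_has_fps_expansion[OF fin, of X] unfolding \<phi>_def by blast
  have "(THE F. (\<lambda>\<xi>. ln (\<phi> \<xi>)) has_fps_expansion F) = L"
    using L by (rule the_equality) (rule real_fps_expansion_unique[OF _ L])
  then have "cumulant (measure_pmf p) X r = fact r * fps_nth L r" for r
    by (simp add: cumulant_def \<phi>_def)
  moreover have "deriv (\<lambda>\<xi>. ln (\<phi> \<xi>)) \<xi> * \<phi> \<xi> = deriv \<phi> \<xi>" for \<xi>
  proof -
    have "\<phi> field_differentiable at \<xi>"
      unfolding \<phi> field_differentiable_def by (rule exI) (auto intro!: derivative_eq_intros)
    then have "(\<phi> has_field_derivative deriv \<phi> \<xi>) (at \<xi>)"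
      using DERIV_deriv_iff_field_differentiable by blast
    then have "((\<lambda>\<xi>. ln (\<phi> \<xi>)) has_field_derivative deriv \<phi> \<xi> / \<phi> \<xi>) (at \<xi>)"
      using pos[of \<xi>] by (auto intro!: derivative_eq_intros)
    from DERIV_imp_deriv[OF this] show ?thesis using pos[of \<xi>] by simp
  qed
  then have "(\<lambda>\<xi>. deriv (\<lambda>\<xi>. ln (\<phi> \<xi>)) \<xi> * \<phi> \<xi>) = deriv \<phi>" by auto
  then have "fps_deriv L * \<Phi> = fps_deriv \<Phi>"
    using has_fps_expansion_mult[OF has_fps_expansion_deriv[OF L] exp\<phi>]
      has_fps_expansion_deriv[OF exp\<phi>] real_fps_expansion_unique by metis
  ultimately show ?thesis unfolding \<Phi>_def by blast
qed

text \<open>The moment series of \<open>b + c * X\<close> is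
  \<open>exp (b \<xi>) * \<Phi> (c \<xi>)\<close>. After taking logarithms, scaling multiplies the
  coefficient of order \<open>r\<close> by \<open>c ^ r\<close>, and the shift only adds
  \<open>b \<xi>\<close>, which is invisible from order 2 on.\<close>

lemma cumulant_affine:
  assumes fin: "finite (set_pmf p)" and r: "r \<ge> 2"
  shows "cumulant (measure_pmf p) (\<lambda>\<omega>. b + c * X \<omega>) r = c ^ r * cumulant (measure_pmf p) X r"
proof -
  define \<Phi> where "\<Phi> = moment_series (measure_pmf p) X"
  define \<Psi> where "\<Psi> = moment_series (measure_pmf p) (\<lambda>\<omega>. b + c * X \<omega>)"
  define S where "S = fps_const c * (fps_X :: real fps)"
  have S0: "fps_nth S 0 = 0" by (simp add: S_def)
  obtain L where L: "fps_deriv L * \<Phi> = fps_deriv \<Phi>"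
    "\<And>r. cumulant (measure_pmf p) X r = fact r * fps_nth L r"
    using cumulant_series[OF fin] unfolding \<Phi>_def by blast
  obtain K where K: "fps_deriv K * \<Psi> = fps_deriv \<Psi>"
    "\<And>r. cumulant (measure_pmf p) (\<lambda>\<omega>. b + c * X \<omega>) r = fact r * fps_nth K r"
    using cumulant_series[OF fin] unfolding \<Psi>_def by blast
  have "\<Psi> = (\<Sum>\<omega>\<in>set_pmf p. fps_const (pmf p \<omega>) * (fps_exp b * (fps_exp (X \<omega>) oo S)))"
    unfolding \<Psi>_def moment_series_pmf[OF fin]
  proof (intro sum.cong refl)
    fix \<omega>
    have "fps_exp (X \<omega>) oo S = fps_exp (c * X \<omega>)"
      by (simp add: S_def fps_compose_linear fps_eq_iff power_mult_distrib)
    then show "fps_const (pmf p \<omega>) * fps_exp (b + c * X \<omega>) =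
      fps_const (pmf p \<omega>) * (fps_exp b * (fps_exp (X \<omega>) oo S))"
      by (simp add: fps_exp_add_mult)
  qed
  also have "\<dots> = fps_exp b * (\<Phi> oo S)"
    unfolding \<Phi>_def moment_series_pmf[OF fin]
    by (simp add: fps_compose_sum_distrib sum_distrib_left fps_compose_mult_distrib[OF S0] mult_ac)
  finally have \<Psi>: "\<Psi> = fps_exp b * (\<Phi> oo S)" .
  \<comment> \<open>The expected logarithm of \<Psi>. It satisfies the same equation as
    \<open>K\<close>; as \<Psi> is a nonzero series it can be cancelled, so both derivatives
    agree.\<close>
  define L' where "L' = fps_const b * fps_X + (L oo S)"
  have dS: "fps_deriv S = fps_const c" by (simp add: S_def)
  have "fps_deriv L' * \<Psi> = fps_deriv \<Psi>"
  proof -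
    have "fps_deriv (\<Phi> oo S) = ((fps_deriv L oo S) * fps_const c) * (\<Phi> oo S)"
      unfolding fps_compose_deriv[OF S0] L(1)[symmetric] fps_compose_mult_distrib[OF S0] dS
      by (simp add: mult_ac)
    moreover have "fps_deriv L' = fps_const b + (fps_deriv L oo S) * fps_const c"
      unfolding L'_def by (simp add: fps_compose_deriv[OF S0] dS)
    ultimately show ?thesis unfolding \<Psi> by (simp add: algebra_simps)
  qed
  moreover have "\<Psi> \<noteq> 0"
    using moment_series_nth_0[of p] unfolding \<Psi>_def by (metis fps_zero_nth zero_neq_one)
  ultimately have "fps_deriv L' = fps_deriv K"
    using K(1) by (metis mult_right_cancel)
  then have "fps_nth (fps_deriv L') (r - 1) = fps_nth (fps_deriv K) (r - 1)" by simp
  then have "fps_nth K r = fps_nth L' r" using r by (simp add: Suc_diff_Suc)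
  also have "\<dots> = c ^ r * fps_nth L r"
    using r by (simp add: L'_def S_def fps_compose_linear)
  finally show ?thesis by (simp add: K(2) L(2))
qed

text \<open>Since \<Phi> has constant term 1, comparing coefficients in
  \<open>L' * \<Phi> = \<Phi>'\<close> expresses each coefficient of \<open>L'\<close> as a
  polynomial in moments and earlier coefficients, without dividing by anything that depends on
  \<open>m\<close>. Convergence then passes along by strong induction.\<close>

lemma cumulants_convergent:
  fixes X :: "nat \<Rightarrow> 'b \<Rightarrow> real"
  assumes fin: "\<And>m. finite (set_pmf (p m))"
    and conv: "\<And>n. convergent (\<lambda>m. \<integral>\<omega>. X m \<omega> ^ n \<partial>measure_pmf (p m))"
    and r: "r \<ge> 1"
  shows "convergent (\<lambda>m. cumulant (measure_pmf (p m)) (X m) r)"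
proof -
  define \<Phi> where "\<Phi> = (\<lambda>m. moment_series (measure_pmf (p m)) (X m))"
  have "\<forall>m. \<exists>L. fps_deriv L * \<Phi> m = fps_deriv (\<Phi> m)
    \<and> (\<forall>r. cumulant (measure_pmf (p m)) (X m) r = fact r * fps_nth L r)"
    using cumulant_series[OF fin] unfolding \<Phi>_def by blast
  then obtain L where L: "\<And>m. fps_deriv (L m) * \<Phi> m = fps_deriv (\<Phi> m)"
    "\<And>m r. cumulant (measure_pmf (p m)) (X m) r = fact r * fps_nth (L m) r"
    by metis
  have \<Phi>0: "fps_nth (\<Phi> m) 0 = 1" for m
    by (simp add: \<Phi>_def moment_series_nth_0)
  have \<Phi>conv: "convergent (\<lambda>m. fps_nth (\<Phi> m) n)" for n
    unfolding \<Phi>_def moment_series_def fps_nth_Abs_fps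
    using convergent_mult[OF conv[of n] convergent_const[of "inverse (fact n)"]]
    by (simp add: divide_inverse)
  have "convergent (\<lambda>m. fps_nth (fps_deriv (L m)) n)" for n
  proof (induction n rule: less_induct)
    case (less n)
    have "fps_nth (fps_deriv (L m)) n = of_nat (n + 1) * fps_nth (\<Phi> m) (n + 1)
      - (\<Sum>i<n. fps_nth (fps_deriv (L m)) i * fps_nth (\<Phi> m) (n - i))" for m
    proof -
      have "of_nat (n + 1) * fps_nth (\<Phi> m) (n + 1) = fps_nth (fps_deriv (L m) * \<Phi> m) n"
        by (simp add: L(1))
      also have "\<dots> = (\<Sum>i\<le>n. fps_nth (fps_deriv (L m)) i * fps_nth (\<Phi> m) (n - i))"
        by (simp add: fps_mult_nth atLeast0AtMost)
      also have "\<dots> = fps_nth (fps_deriv (L m)) n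
          + (\<Sum>i<n. fps_nth (fps_deriv (L m)) i * fps_nth (\<Phi> m) (n - i))"
        by (simp add: lessThan_Suc_atMost[symmetric] \<Phi>0 del: fps_deriv_nth)
      finally show ?thesis by simp
    qed
    then show ?case
      using less.IH \<Phi>conv
      by (simp only:) (intro convergent_diff convergent_mult convergent_const convergent_sum; simp)
  qed
  from this[of "r - 1"] have "convergent (\<lambda>m. of_nat r * fps_nth (L m) r)"
    using r by simp
  then have "convergent (\<lambda>m. fact r / of_nat r * (of_nat r * fps_nth (L m) r))"
    using convergent_mult convergent_const by blast
  moreover have "fact r / of_nat r * (of_nat r * x) = fact r * x" for x :: real
    using r by simp
  ultimately show ?thesis by (simp only: L(2))
qed

section \<open>The bounded difference inequality\<close>

text \<open>Hoeffding's lemma for the interval from \<open>-c\<close> to \<open>c\<close>: its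
  length \<open>2 * c\<close> turns the exponent \<open>l^2 * (2 * c)^2 / 8\<close> into
  \<open>l^2 * c^2 / 2\<close>.\<close>

lemma (in prob_space) expectation_exp_le:
  fixes X :: "'a \<Rightarrow> real"
  assumes [measurable]: "random_variable borel X" and E0: "expectation X = 0"
    and bound: "\<And>x. x \<in> space M \<Longrightarrow> \<bar>X x\<bar> \<le> c" and l: "l > 0"
  shows "expectation (\<lambda>x. exp (l * X x)) \<le> exp (l\<^sup>2 * c\<^sup>2 / 2)"
proof -
  interpret interval_bounded_random_variable M X "-c" c
  proof
    show "AE x in M. X x \<in> {-c..c}"
      using bound by (intro AE_I2) (auto simp: abs_le_iff minus_le_iff)
  qed fact
  have "integrable M (\<lambda>x. exp (l * X x))"
    using bound l
    by (intro integrable_const_bound[where B = "exp (l * c)"] AE_I2) (auto simp: abs_le_iff)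
  then have "ennreal (expectation (\<lambda>x. exp (l * X x))) = (\<integral>\<^sup>+x. exp (l * X x) \<partial>M)"
    by (intro nn_integral_eq_integral[symmetric]) auto
  also have "\<dots> \<le> ennreal (exp (l\<^sup>2 * (c - (-c))\<^sup>2 / 8))"
    by (rule Hoeffdings_lemma_nn_integral_0[OF l E0])
  finally have "expectation (\<lambda>x. exp (l * X x)) \<le> exp (l\<^sup>2 * (c - (-c))\<^sup>2 / 8)"
    by (simp add: ennreal_le_iff)
  also have "l\<^sup>2 * (c - (-c))\<^sup>2 / 8 = l\<^sup>2 * c\<^sup>2 / 2"
    by (simp add: power2_eq_square)
  finally show ?thesis .
qed

lemma power_le_fact_mult_exp:
  fixes x :: real
  assumes "x \<ge> 0"
  shows "x ^ n \<le> fact n * exp x"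
proof -
  have "(\<Sum>i<Suc n. inverse (fact i) * x ^ i) \<le> exp x"
    using assms summable_exp[of x] sum_le_suminf[of "\<lambda>i. inverse (fact i) * x ^ i" "{..<Suc n}"]
    by (simp add: exp_def)
  moreover have "inverse (fact n) * x ^ n \<le> (\<Sum>i<Suc n. inverse (fact i) * x ^ i)"
    using assms by (simp add: sum_nonneg)
  ultimately show ?thesis
    by (simp add: field_simps)
qed

context product_prob_space
begin

lemma prob_space_PiM_index: "prob_space (PiM J M)"
  by (intro prob_space_PiM prob_space)

text \<open>McDiarmid's argument, by induction on the coordinates. Averaging out coordinate
  \<open>i\<close> gives a function with the same mean and the same difference bounds in the other
  coordinates; the deviation from it is centred and at most \<open>c i\<close>, so Hoeffding's lemma
  contributes one factor. Bounding that deviation in absolute value costs a factor 4 in the exponent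
  against the sharp inequality, which is harmless here.\<close>

lemma bounded_differences_exp:
  fixes f :: "('i \<Rightarrow> 'a) \<Rightarrow> real"
  assumes "finite J" and f: "f \<in> borel_measurable (PiM J M)"
    and bound: "\<And>x. x \<in> space (PiM J M) \<Longrightarrow> \<bar>f x\<bar> \<le> B"
    and diff: "\<And>x i y. x \<in> space (PiM J M) \<Longrightarrow> i \<in> J \<Longrightarrow> y \<in> space (M i) \<Longrightarrow>
      \<bar>f (x(i := y)) - f x\<bar> \<le> c i"
    and l: "l > 0"
  shows "(\<integral>x. exp (l * (f x - integral\<^sup>L (PiM J M) f)) \<partial>PiM J M) \<le> exp (l\<^sup>2 * (\<Sum>i\<in>J. (c i)\<^sup>2) / 2)"
  using assms(1-4)
proof (induction J arbitrary: f rule: finite_induct)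
  case empty
  \<comment> \<open>The product over no coordinates lives on a single point, so \<open>f\<close>
    equals its mean and both sides are 1.\<close>
  have [simp]: "integral\<^sup>L (PiM {} M) h = h (\<lambda>_. undefined)" for h :: "('i \<Rightarrow> 'a) \<Rightarrow> real"
  proof -
    have "integral\<^sup>L (PiM {} M) h = (\<integral>x. h (\<lambda>_. undefined) \<partial>PiM {} M)"
      by (intro Bochner_Integration.integral_cong) (auto simp: space_PiM)
    then show ?thesis
      using prob_space.prob_space[OF prob_space_PiM_index[of "{}"]] by simp
  qed
  show ?case by simp
next
  case (insert i J)
  note [measurable] = insert.prems(1)
  interpret J: prob_space "PiM J M" by (rule prob_space_PiM_index)
  interpret iJ: prob_space "PiM (insert i J) M" by (rule prob_space_PiM_index)
  \<comment> \<open>The conditional expectation of \<open>f\<close> given all coordinates other than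
    \<open>i\<close>.\<close>
  define g where "g = (\<lambda>x. \<integral>y. f (x(i := y)) \<partial>M i)"
  have upd: "x(i := y) \<in> space (PiM (insert i J) M)"
    if "x \<in> space (PiM J M)" "y \<in> space (M i)" for x y
    using that by (auto simp: space_PiM PiE_iff extensional_def)
  have meas_pair [measurable]: "(\<lambda>(x, y). f (x(i := y))) \<in> borel_measurable (PiM J M \<Otimes>\<^sub>M M i)"
    using measurable_comp[OF measurable_add_dim insert.prems(1)] by (simp add: comp_def case_prod_beta)
  have g_meas [measurable]: "g \<in> borel_measurable (PiM J M)"
    unfolding g_def by (rule M.borel_measurable_lebesgue_integral) measurable
  have sect [measurable]: "(\<lambda>y. f (x(i := y))) \<in> borel_measurable (M i)" if "x \<in> space (PiM J M)" for x
    using measurable_Pair2[OF meas_pair that] by simp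
  have f_bound: "\<bar>f (x(i := y))\<bar> \<le> B" if "x \<in> space (PiM J M)" "y \<in> space (M i)" for x y
    using insert.prems(2)[OF upd[OF that]] .
  have sect_int: "integrable (M i) (\<lambda>y. f (x(i := y)))" if "x \<in> space (PiM J M)" for x
    using f_bound that sect[OF that]
    by (intro M.integrable_const_bound[where B = B] AE_I2) auto
  have f_int: "integrable (PiM (insert i J) M) f"
    using insert.prems(2) by (intro iJ.integrable_const_bound[where B = B] AE_I2) auto
  have g_bound: "\<bar>g x\<bar> \<le> B" if "x \<in> space (PiM J M)" for x
  proof -
    have "\<bar>g x\<bar> \<le> (\<integral>y. \<bar>f (x(i := y))\<bar> \<partial>M i)"
      unfolding g_def using integral_norm_bound[of "M i" "\<lambda>y. f (x(i := y))"] by simp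
    also have "\<dots> \<le> (\<integral>y. B \<partial>M i)"
      using sect_int[OF that] f_bound that
      by (intro integral_mono) auto
    finally show ?thesis by (simp add: M.prob_space)
  qed
  have g_diff: "\<bar>g (x(j := z)) - g x\<bar> \<le> c j"
    if x: "x \<in> space (PiM J M)" and j: "j \<in> J" and z: "z \<in> space (M j)" for x j z
  proof -
    have xz: "x(j := z) \<in> space (PiM J M)"
      using x j z by (auto simp: space_PiM PiE_iff extensional_def)
    have "\<bar>g (x(j := z)) - g x\<bar> = \<bar>\<integral>y. f (x(j := z, i := y)) - f (x(i := y)) \<partial>M i\<bar>"
      unfolding g_def using sect_int[OF x] sect_int[OF xz]
      by (subst Bochner_Integration.integral_diff) auto
    also have "\<dots> \<le> (\<integral>y. \<bar>f (x(j := z, i := y)) - f (x(i := y))\<bar> \<partial>M i)"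
      using integral_norm_bound[of "M i" "\<lambda>y. f (x(j := z, i := y)) - f (x(i := y))"] by simp
    also have "\<dots> \<le> (\<integral>y. c j \<partial>M i)"
    proof (intro integral_mono)
      show "\<bar>f (x(j := z, i := y)) - f (x(i := y))\<bar> \<le> c j" if "y \<in> space (M i)" for y
      proof -
        have "x(j := z, i := y) = x(i := y, j := z)"
          using j insert.hyps by (intro fun_upd_twist) auto
        moreover have "\<bar>f (x(i := y, j := z)) - f (x(i := y))\<bar> \<le> c j"
          by (rule insert.prems(3)[OF upd[OF x that]]) (use j z in auto)
        ultimately show ?thesis by simp
      qed
    qed (use sect_int[OF x] sect_int[OF xz] in auto)
    finally show ?thesis by (simp add: M.prob_space)
  qed
  define \<mu> where "\<mu> = integral\<^sup>L (PiM (insert i J) M) f"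
  have \<mu>: "\<mu> = integral\<^sup>L (PiM J M) g"
    unfolding \<mu>_def g_def using product_integral_insert[OF insert.hyps f_int] by simp
  have IH: "(\<integral>x. exp (l * (g x - \<mu>)) \<partial>PiM J M) \<le> exp (l\<^sup>2 * (\<Sum>i\<in>J. (c i)\<^sup>2) / 2)"
    unfolding \<mu> by (rule insert.IH[OF g_meas g_bound g_diff])
  have e_bound: "exp (l * (t - \<mu>)) \<le> exp (l * (B + \<bar>\<mu>\<bar>))" if "\<bar>t\<bar> \<le> B" for t
    using that l by (auto simp: abs_le_iff)
  have e_int: "integrable (PiM (insert i J) M) (\<lambda>x. exp (l * (f x - \<mu>)))"
    using e_bound[OF insert.prems(2)]
    by (intro iJ.integrable_const_bound[where B = "exp (l * (B + \<bar>\<mu>\<bar>))"] AE_I2) auto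
  have eg_int: "integrable (PiM J M) (\<lambda>x. exp (l * (g x - \<mu>)))"
    using e_bound[OF g_bound]
    by (intro J.integrable_const_bound[where B = "exp (l * (B + \<bar>\<mu>\<bar>))"] AE_I2) auto
  have inner: "(\<integral>y. exp (l * (f (x(i := y)) - \<mu>)) \<partial>M i) \<le> exp (l\<^sup>2 * (c i)\<^sup>2 / 2) * exp (l * (g x - \<mu>))"
    if x: "x \<in> space (PiM J M)" for x
  proof -
    have "\<bar>f (x(i := y)) - g x\<bar> \<le> c i" if y: "y \<in> space (M i)" for y
    proof -
      have "\<bar>f (x(i := y)) - g x\<bar> = \<bar>\<integral>z. f (x(i := y)) - f (x(i := z)) \<partial>M i\<bar>"
        unfolding g_def using sect_int[OF x]
        by (subst Bochner_Integration.integral_diff) (auto simp: M.prob_space)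
      also have "\<dots> \<le> (\<integral>z. \<bar>f (x(i := y)) - f (x(i := z))\<bar> \<partial>M i)"
        using integral_norm_bound[of "M i" "\<lambda>z. f (x(i := y)) - f (x(i := z))"] by simp
      also have "\<dots> \<le> (\<integral>z. c i \<partial>M i)"
      proof (intro integral_mono)
        show "\<bar>f (x(i := y)) - f (x(i := z))\<bar> \<le> c i" if "z \<in> space (M i)" for z
        proof -
          have "\<bar>f (x(i := z, i := y)) - f (x(i := z))\<bar> \<le> c i"
            by (rule insert.prems(3)[OF upd[OF x that]]) (use y in auto)
          then show ?thesis by simp
        qed
      qed (use sect_int[OF x] in auto)
      finally show ?thesis by (simp add: M.prob_space)
    qed
    moreover have "(\<integral>y. f (x(i := y)) - g x \<partial>M i) = 0"
      using sect_int[OF x] by (subst Bochner_Integration.integral_diff) (auto simp: M.prob_space g_def)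
    ultimately have "(\<integral>y. exp (l * (f (x(i := y)) - g x)) \<partial>M i) \<le> exp (l\<^sup>2 * (c i)\<^sup>2 / 2)"
      using l sect[OF x] by (intro M.expectation_exp_le) auto
    then have "(\<integral>y. exp (l * (f (x(i := y)) - g x)) \<partial>M i) * exp (l * (g x - \<mu>))
        \<le> exp (l\<^sup>2 * (c i)\<^sup>2 / 2) * exp (l * (g x - \<mu>))"
      by (intro mult_right_mono) auto
    also have "(\<integral>y. exp (l * (f (x(i := y)) - g x)) \<partial>M i) * exp (l * (g x - \<mu>)) =
        (\<integral>y. exp (l * (f (x(i := y)) - g x)) * exp (l * (g x - \<mu>)) \<partial>M i)"
      by simp
    also have "\<dots> = (\<integral>y. exp (l * (f (x(i := y)) - \<mu>)) \<partial>M i)"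
      by (intro Bochner_Integration.integral_cong) (auto simp: exp_add[symmetric] algebra_simps)
    finally show ?thesis .
  qed
  have "(\<integral>x. exp (l * (f x - \<mu>)) \<partial>PiM (insert i J) M) =
      (\<integral>x. (\<integral>y. exp (l * (f (x(i := y)) - \<mu>)) \<partial>M i) \<partial>PiM J M)"
    by (rule product_integral_insert[OF insert.hyps e_int])
  also have "\<dots> \<le> (\<integral>x. exp (l\<^sup>2 * (c i)\<^sup>2 / 2) * exp (l * (g x - \<mu>)) \<partial>PiM J M)"
    using inner eg_int by (intro integral_mono_AE' AE_I2) auto
  also have "\<dots> \<le> exp (l\<^sup>2 * (c i)\<^sup>2 / 2) * exp (l\<^sup>2 * (\<Sum>i\<in>J. (c i)\<^sup>2) / 2)"
    using IH by simp
  also have "\<dots> = exp (l\<^sup>2 * (\<Sum>i\<in>insert i J. (c i)\<^sup>2) / 2)"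
    using insert.hyps by (simp add: exp_add[symmetric] field_simps)
  finally show ?case unfolding \<mu>_def .
qed

text \<open>The choice \<open>l = 1 / \<sigma>\<close> brings the exponent down to at most 1/2. The
  exponential bound is used for \<open>f\<close> and for \<open>-f\<close>, because
  \<open>exp \<bar>t\<bar> \<le> exp t + exp (- t)\<close>, and
  \<open>\<bar>t\<bar> ^ p \<le> fact p * exp \<bar>t\<bar>\<close> converts it into a bound on the
  absolute moment.\<close>

theorem bounded_differences_moment:
  fixes f :: "('i \<Rightarrow> 'a) \<Rightarrow> real"
  assumes J: "finite J" and f [measurable]: "f \<in> borel_measurable (PiM J M)"
    and bound: "\<And>x. x \<in> space (PiM J M) \<Longrightarrow> \<bar>f x\<bar> \<le> B"
    and diff: "\<And>x i y. x \<in> space (PiM J M) \<Longrightarrow> i \<in> J \<Longrightarrow> y \<in> space (M i) \<Longrightarrow>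
      \<bar>f (x(i := y)) - f x\<bar> \<le> c i"
    and \<sigma>: "\<sigma> > 0" "(\<Sum>i\<in>J. (c i)\<^sup>2) \<le> \<sigma>\<^sup>2"
  shows "(\<integral>x. \<bar>f x - integral\<^sup>L (PiM J M) f\<bar> ^ p \<partial>PiM J M) \<le> 2 * fact p * exp (1 / 2) * \<sigma> ^ p"
proof -
  interpret PJ: prob_space "PiM J M" by (rule prob_space_PiM_index)
  define \<mu> where "\<mu> = integral\<^sup>L (PiM J M) f"
  define l where "l = 1 / \<sigma>"
  have l: "l > 0" using \<sigma> by (simp add: l_def)
  have "l\<^sup>2 * (\<Sum>i\<in>J. (c i)\<^sup>2) / 2 \<le> 1 / 2"
    using \<sigma> by (simp add: l_def power_divide divide_simps)
  then have small: "exp (l\<^sup>2 * (\<Sum>i\<in>J. (c i)\<^sup>2) / 2) \<le> exp (1 / 2)" by simp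
  have 1: "(\<integral>x. exp (l * (f x - \<mu>)) \<partial>PiM J M) \<le> exp (1 / 2)"
    using bounded_differences_exp[OF J f bound diff l] small unfolding \<mu>_def by linarith
  have "(\<integral>x. exp (l * (- f x - integral\<^sup>L (PiM J M) (\<lambda>x. - f x))) \<partial>PiM J M)
      \<le> exp (l\<^sup>2 * (\<Sum>i\<in>J. (c i)\<^sup>2) / 2)"
  proof (rule bounded_differences_exp[OF J _ _ _ l, where B = B])
    show "\<bar>- f (x(i := y)) - - f x\<bar> \<le> c i"
      if "x \<in> space (PiM J M)" "i \<in> J" "y \<in> space (M i)" for x i y
      using diff[OF that] by linarith
  qed (use bound in auto)
  from order_trans[OF this small]
  have 2: "(\<integral>x. exp (- l * (f x - \<mu>)) \<partial>PiM J M) \<le> exp (1 / 2)"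
    unfolding \<mu>_def by (simp add: algebra_simps)
  have e_int: "integrable (PiM J M) (\<lambda>x. exp (t * (f x - \<mu>)))" for t
  proof (intro PJ.integrable_const_bound[where B = "exp (\<bar>t\<bar> * (B + \<bar>\<mu>\<bar>))"] AE_I2)
    fix x assume "x \<in> space (PiM J M)"
    then have "\<bar>f x - \<mu>\<bar> \<le> B + \<bar>\<mu>\<bar>" using bound[of x] by linarith
    then have "\<bar>t\<bar> * \<bar>f x - \<mu>\<bar> \<le> \<bar>t\<bar> * (B + \<bar>\<mu>\<bar>)" by (intro mult_left_mono) auto
    then have "t * (f x - \<mu>) \<le> \<bar>t\<bar> * (B + \<bar>\<mu>\<bar>)"
      using abs_ge_self[of "t * (f x - \<mu>)"] by (simp add: abs_mult)
    then show "norm (exp (t * (f x - \<mu>))) \<le> exp (\<bar>t\<bar> * (B + \<bar>\<mu>\<bar>))" by simp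
  qed measurable
  have "(\<integral>x. \<bar>f x - \<mu>\<bar> ^ p \<partial>PiM J M)
      \<le> (\<integral>x. \<sigma> ^ p * fact p * (exp (l * (f x - \<mu>)) + exp (- l * (f x - \<mu>))) \<partial>PiM J M)"
  proof (rule integral_mono_AE')
    show "AE x in PiM J M. \<bar>f x - \<mu>\<bar> ^ p
        \<le> \<sigma> ^ p * fact p * (exp (l * (f x - \<mu>)) + exp (- l * (f x - \<mu>)))"
    proof (rule AE_I2)
      fix x
      have "exp (l * \<bar>f x - \<mu>\<bar>) \<le> exp (l * (f x - \<mu>)) + exp (- l * (f x - \<mu>))"
        by (cases "f x \<ge> \<mu>") (auto simp: algebra_simps)
      then have "fact p * exp (l * \<bar>f x - \<mu>\<bar>)
          \<le> fact p * (exp (l * (f x - \<mu>)) + exp (- l * (f x - \<mu>)))"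
        by (intro mult_left_mono) auto
      moreover have "(l * \<bar>f x - \<mu>\<bar>) ^ p \<le> fact p * exp (l * \<bar>f x - \<mu>\<bar>)"
        using l by (intro power_le_fact_mult_exp) auto
      ultimately have "(l * \<bar>f x - \<mu>\<bar>) ^ p \<le> fact p * (exp (l * (f x - \<mu>)) + exp (- l * (f x - \<mu>)))"
        by (rule order_trans[rotated])
      then have "\<sigma> ^ p * (l * \<bar>f x - \<mu>\<bar>) ^ p
          \<le> \<sigma> ^ p * (fact p * (exp (l * (f x - \<mu>)) + exp (- l * (f x - \<mu>))))"
        using \<sigma>(1) by (intro mult_left_mono) auto
      also have "\<sigma> ^ p * (l * \<bar>f x - \<mu>\<bar>) ^ p = \<bar>f x - \<mu>\<bar> ^ p"
        using \<sigma>(1) by (simp add: l_def power_mult_distrib[symmetric])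
      finally show "\<bar>f x - \<mu>\<bar> ^ p
          \<le> \<sigma> ^ p * fact p * (exp (l * (f x - \<mu>)) + exp (- l * (f x - \<mu>)))"
        by (simp add: mult_ac)
    qed
  next
    show "integrable (PiM J M) (\<lambda>x. \<sigma> ^ p * fact p * (exp (l * (f x - \<mu>)) + exp (- l * (f x - \<mu>))))"
      by (intro integrable_mult_right Bochner_Integration.integrable_add e_int)
  qed (use \<sigma>(1) in auto)
  also have "\<dots> = \<sigma> ^ p * fact p *
      ((\<integral>x. exp (l * (f x - \<mu>)) \<partial>PiM J M) + (\<integral>x. exp (- l * (f x - \<mu>)) \<partial>PiM J M))"
    using Bochner_Integration.integral_add[OF e_int[of l] e_int[of "-l"]] by simp
  also have "\<dots> \<le> \<sigma> ^ p * fact p * (exp (1 / 2) + exp (1 / 2))"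
    using 1 2 \<sigma>(1) by (intro mult_left_mono add_mono) auto
  finally show ?thesis unfolding \<mu>_def by (simp add: mult_ac)
qed

end

section \<open>Independent uniform labels\<close>

definition unif :: "real measure" where
  "unif = uniform_measure lborel {0..1}"

lemma prob_space_unif: "prob_space unif"
  unfolding unif_def by (rule prob_space_uniform_measure) auto

lemma sets_unif [simp, measurable_cong]: "sets unif = sets borel"
  by (simp add: unif_def)

lemma space_unif [simp]: "space unif = UNIV"
  by (simp add: unif_def)

lemma emeasure_unif_singleton: "emeasure unif {x} = 0"
proof -
  have "emeasure lborel ({0..1} \<inter> {x}) \<le> emeasure lborel {x}"
    by (intro emeasure_mono) auto
  then show ?thesis by (simp add: unif_def emeasure_uniform_measure)
qed

abbreviation iid :: "'i set \<Rightarrow> ('i \<Rightarrow> real) measure" where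
  "iid J \<equiv> PiM J (\<lambda>_. unif)"

lemma prob_space_iid: "prob_space (iid J)"
  by (intro prob_space_PiM prob_space_unif)

lemma product_prob_space_unif: "product_prob_space (\<lambda>_. unif)"
  by (simp add: product_prob_space_def product_prob_space_axioms_def product_sigma_finite_def
      prob_space_unif prob_space_imp_sigma_finite)

text \<open>By Fubini with the label of \<open>u\<close> integrated first: once all other labels are
  fixed, a tie with \<open>v\<close> is a single point, which is a null set for the uniform
  law.\<close>

lemma AE_iid_neq:
  assumes T: "finite T" and u: "u \<in> T" and v: "v \<in> T" and neq: "u \<noteq> v"
  shows "AE \<omega> in iid T. \<omega> u \<noteq> \<omega> v"
proof -
  interpret product_prob_space "\<lambda>_. unif" by (rule product_prob_space_unif)
  define S where "S = T - {u}"
  have S: "finite S" "u \<notin> S" "v \<in> S" and TS: "T = insert u S"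
    using T u v neq by (auto simp: S_def)
  have [measurable]: "(\<lambda>\<omega>. \<omega> u) \<in> borel_measurable (iid T)" "(\<lambda>\<omega>. \<omega> v) \<in> borel_measurable (iid T)"
    using u v by (auto intro: measurable_component_singleton[where M = "\<lambda>_. unif", simplified])
  define N where "N = {\<omega> \<in> space (iid T). \<omega> u = \<omega> v}"
  have N [measurable]: "N \<in> sets (iid T)" unfolding N_def by measurable
  have ind: "(indicator N :: _ \<Rightarrow> ennreal) \<in> borel_measurable (iid (insert u S))"
    using N TS by simp
  have "emeasure (iid T) N = (\<integral>\<^sup>+\<omega>. indicator N \<omega> \<partial>iid (insert u S))"
    using N TS by simp
  also have "\<dots> = (\<integral>\<^sup>+x. (\<integral>\<^sup>+y. indicator N (x(u := y)) \<partial>unif) \<partial>iid S)"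
    by (rule product_nn_integral_insert[OF S(1,2) ind])
  also have "\<dots> = (\<integral>\<^sup>+x. (\<integral>\<^sup>+y. indicator {x v} y \<partial>unif) \<partial>iid S)"
  proof (intro nn_integral_cong)
    fix x y assume "x \<in> space (iid S)"
    then have "x(u := y) \<in> space (iid T)"
      unfolding TS by (auto simp: space_PiM PiE_iff extensional_def)
    then show "(indicator N (x(u := y)) :: ennreal) = indicator {x v} y"
      using neq by (auto simp: N_def indicator_def)
  qed
  also have "\<dots> = 0" by (simp add: emeasure_unif_singleton)
  finally have "N \<in> null_sets (iid T)" using N by auto
  then show ?thesis by (rule AE_I') (auto simp: N_def)
qed

lemma AE_iid_inj_on:
  assumes "finite T"
  shows "AE \<omega> in iid T. inj_on \<omega> T"
proof -
  have "AE \<omega> in iid T. \<forall>u\<in>T. \<forall>v\<in>T. u \<noteq> v \<longrightarrow> \<omega> u \<noteq> \<omega> v"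
    using assms AE_iid_neq[OF assms] by (intro AE_finite_allI) auto
  then show ?thesis by eventually_elim (auto simp: inj_on_def)
qed

text \<open>Polymorphic version of \<open>same_relative_order\<close>, so that integer labellings
  and real labels are handled by one notion.\<close>

definition same_order :: "'b::linorder list \<Rightarrow> nat list \<Rightarrow> bool" where
  "same_order xs ys \<longleftrightarrow>
     length xs = length ys \<and>
     (\<forall>i<length xs. \<forall>j<length xs. xs ! i < xs ! j \<longleftrightarrow> ys ! i < ys ! j)"

text \<open>The family \<open>C\<close> and the index type are left free: the count is taken over
  the chains of a tree, over single chains, and over the abstract word
  \<open>[0..<k]\<close>.\<close>

definition occurrences :: "nat list \<Rightarrow> 'i list set \<Rightarrow> ('i \<Rightarrow> 'b::linorder) \<Rightarrow> real" where
  "occurrences \<alpha> C \<omega> = (\<Sum>us\<in>C. of_bool (same_order (map \<omega> us) \<alpha>))"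

lemma pattern_count_eq_occurrences:
  "pattern_count \<alpha> T = occurrences \<alpha> (chains (length \<alpha>) T)"
  by (simp add: pattern_count_def occurrences_def same_order_def same_relative_order_def fun_eq_iff)

lemma same_order_cong:
  assumes "\<And>u v. u \<in> set us \<Longrightarrow> v \<in> set us \<Longrightarrow> f u < f v \<longleftrightarrow> g u < g v"
  shows "same_order (map f us) \<alpha> = same_order (map g us) \<alpha>"
  using assms unfolding same_order_def by auto

lemma occurrences_cong:
  assumes "\<And>us u v. us \<in> C \<Longrightarrow> u \<in> set us \<Longrightarrow> v \<in> set us \<Longrightarrow> f u < f v \<longleftrightarrow> g u < g v"
  shows "occurrences \<alpha> C f = occurrences \<alpha> C g"
  unfolding occurrences_def using assms by (intro sum.cong arg_cong[where f = of_bool] same_order_cong) auto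

lemma occurrences_measurable [measurable]:
  fixes C :: "'i list set"
  assumes "\<And>us. us \<in> C \<Longrightarrow> set us \<subseteq> T"
  shows "occurrences \<alpha> C \<in> borel_measurable (iid T)"
proof -
  have cmp: "Measurable.pred (iid T) (\<lambda>\<omega>. (\<omega> u < \<omega> v) = c)" if "u \<in> T" "v \<in> T" for u v c
  proof -
    have "(\<lambda>\<omega>. \<omega> u) \<in> borel_measurable (iid T)" "(\<lambda>\<omega>. \<omega> v) \<in> borel_measurable (iid T)"
      using that by (auto intro: measurable_component_singleton[where M = "\<lambda>_. unif", simplified])
    then have "Measurable.pred (iid T) (\<lambda>\<omega>. \<omega> u < \<omega> v)"
      by (rule borel_measurable_pred_less)
    then show ?thesis by (cases c) (auto intro: pred_intros_logic)
  qed
  have "(\<lambda>\<omega>. of_bool (same_order (map \<omega> us) \<alpha>) :: real) \<in> borel_measurable (iid T)" if us: "us \<in> C" for us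
  proof -
    \<comment> \<open>The quantifiers are rewritten to range over finite sets, so that the event
      becomes a finite intersection of comparisons of two labels.\<close>
    have eq: "(\<lambda>\<omega>. of_bool (same_order (map \<omega> us) \<alpha>) :: real) =
      (\<lambda>\<omega>. of_bool (length us = length \<alpha>) * of_bool (\<forall>i\<in>{..<length us}. \<forall>j\<in>{..<length us}.
        (\<omega> (us ! i) < \<omega> (us ! j)) = (\<alpha> ! i < \<alpha> ! j)))"
      by (auto simp: same_order_def fun_eq_iff)
    have "us ! i \<in> T" if "i < length us" for i
      using assms[OF us] that by auto
    then have "Measurable.pred (iid T) (\<lambda>\<omega>. \<forall>i\<in>{..<length us}. \<forall>j\<in>{..<length us}.
        (\<omega> (us ! i) < \<omega> (us ! j)) = (\<alpha> ! i < \<alpha> ! j))"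
      by (intro pred_intros_finite(3) finite_lessThan cmp) auto
    from measurable_compose[OF this measurable_of_bool]
    have "(\<lambda>\<omega>. of_bool (length us = length \<alpha>) * of_bool (\<forall>i\<in>{..<length us}. \<forall>j\<in>{..<length us}.
        (\<omega> (us ! i) < \<omega> (us ! j)) = (\<alpha> ! i < \<alpha> ! j)) :: real) \<in> borel_measurable (iid T)"
      by (rule borel_measurable_times[OF borel_measurable_const])
    then show ?thesis by (subst eq)
  qed
  then show ?thesis unfolding occurrences_def[abs_def] by (intro borel_measurable_sum)
qed

text \<open>One fixed labelling identifies the labellings with the permutations of the nodes. This
  is what turns a sum over labellings into a sum over rearrangements of given real labels.\<close>

lemma bij_betw_permutations_labellings:
  assumes T: "finite T" and \<rho>: "bij_betw \<rho> T {1..card T}"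
  shows "bij_betw (\<lambda>\<sigma>. restrict (\<rho> \<circ> \<sigma>) T) {\<sigma>. \<sigma> permutes T} (labellings T)"
proof (rule bij_betwI')
  fix \<sigma> \<tau> assume "\<sigma> \<in> {\<sigma>. \<sigma> permutes T}" "\<tau> \<in> {\<sigma>. \<sigma> permutes T}"
  then have p: "\<sigma> permutes T" "\<tau> permutes T" by auto
  show "restrict (\<rho> \<circ> \<sigma>) T = restrict (\<rho> \<circ> \<tau>) T \<longleftrightarrow> \<sigma> = \<tau>"
  proof
    assume eq: "restrict (\<rho> \<circ> \<sigma>) T = restrict (\<rho> \<circ> \<tau>) T"
    have "\<sigma> x = \<tau> x" for x
    proof (cases "x \<in> T")
      case True
      then have "\<rho> (\<sigma> x) = \<rho> (\<tau> x)" using fun_cong[OF eq, of x] by simp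
      moreover have "\<sigma> x \<in> T" "\<tau> x \<in> T" using True p permutes_in_image by metis+
      ultimately show ?thesis using \<rho> by (auto simp: bij_betw_def inj_on_def)
    next
      case False
      then show ?thesis using p by (simp add: permutes_not_in)
    qed
    then show "\<sigma> = \<tau>" by auto
  qed auto
next
  fix \<sigma> assume "\<sigma> \<in> {\<sigma>. \<sigma> permutes T}"
  then have "bij_betw (\<rho> \<circ> \<sigma>) T {1..card T}"
    using \<rho> by (auto intro: bij_betw_trans permutes_imp_bij)
  then have "bij_betw (restrict (\<rho> \<circ> \<sigma>) T) T {1..card T}"
    by (simp cong: bij_betw_cong)
  then show "restrict (\<rho> \<circ> \<sigma>) T \<in> labellings T"
    by (auto simp: labellings_def dest: bij_betwE)
next
  fix \<pi> assume "\<pi> \<in> labellings T"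
  then have \<pi>: "\<pi> \<in> extensional T" "bij_betw \<pi> T {1..card T}"
    by (auto simp: labellings_def PiE_def)
  define \<sigma> where "\<sigma> = (\<lambda>x. if x \<in> T then inv_into T \<rho> (\<pi> x) else x)"
  have "bij_betw (inv_into T \<rho> \<circ> \<pi>) T T"
    using bij_betw_trans[OF \<pi>(2) bij_betw_inv_into[OF \<rho>]] .
  then have "bij_betw \<sigma> T T"
    by (rule bij_betw_cong[THEN iffD1, rotated]) (simp add: \<sigma>_def)
  then have "\<sigma> permutes T" by (intro bij_imp_permutes) (auto simp: \<sigma>_def)
  moreover have "\<pi> = restrict (\<rho> \<circ> \<sigma>) T"
  proof
    fix x
    have "\<rho> (inv_into T \<rho> (\<pi> x)) = \<pi> x" if "x \<in> T"
      using bij_betwE[OF \<pi>(2)] that \<rho> bij_betw_inv_into_right by metis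
    then show "\<pi> x = restrict (\<rho> \<circ> \<sigma>) T x"
      using \<pi>(1) by (auto simp: \<sigma>_def extensional_def)
  qed
  ultimately show "\<exists>\<sigma>\<in>{\<sigma>. \<sigma> permutes T}. \<pi> = restrict (\<rho> \<circ> \<sigma>) T" by blast
qed

lemma card_labellings:
  assumes "finite T"
  shows "card (labellings T) = fact (card T)"
proof -
  obtain \<rho> where "bij_betw \<rho> T {1..card T}"
    using assms finite_same_card_bij[of T "{1..card T}"] by auto
  from bij_betw_same_card[OF bij_betw_permutations_labellings[OF assms this]] show ?thesis
    using card_permutations[OF refl assms] by simp
qed

text \<open>The witness is the rank of a label; counting with \<open>\<le>\<close> includes the node
  itself, so ranks start at 1.\<close>

lemma order_preserving_labelling:
  fixes \<omega> :: "'i \<Rightarrow> real"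
  assumes T: "finite T" and inj: "inj_on \<omega> T"
  obtains \<rho> where "bij_betw \<rho> T {1..card T}" "\<And>u v. u \<in> T \<Longrightarrow> v \<in> T \<Longrightarrow> \<rho> u < \<rho> v \<longleftrightarrow> \<omega> u < \<omega> v"
proof -
  define \<rho> where "\<rho> = (\<lambda>u. card {v \<in> T. \<omega> v \<le> \<omega> u})"
  have mono: "\<rho> u < \<rho> v" if "u \<in> T" "v \<in> T" "\<omega> u < \<omega> v" for u v
  proof -
    have "v \<in> {w \<in> T. \<omega> w \<le> \<omega> v}" "v \<notin> {w \<in> T. \<omega> w \<le> \<omega> u}" using that by auto
    moreover have "{w \<in> T. \<omega> w \<le> \<omega> u} \<subseteq> {w \<in> T. \<omega> w \<le> \<omega> v}" using that by auto
    ultimately have "{w \<in> T. \<omega> w \<le> \<omega> u} \<subset> {w \<in> T. \<omega> w \<le> \<omega> v}" by blast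
    then show ?thesis unfolding \<rho>_def using T by (intro psubset_card_mono) auto
  qed
  have iff: "\<rho> u < \<rho> v \<longleftrightarrow> \<omega> u < \<omega> v" if "u \<in> T" "v \<in> T" for u v
  proof
    assume less: "\<rho> u < \<rho> v"
    then have "\<omega> u \<noteq> \<omega> v" by (auto simp: \<rho>_def)
    moreover have "\<not> \<omega> v < \<omega> u" using mono[OF that(2,1)] less by auto
    ultimately show "\<omega> u < \<omega> v" by linarith
  qed (rule mono[OF that])
  have "inj_on \<rho> T"
  proof (rule inj_onI)
    fix u v assume uv: "u \<in> T" "v \<in> T" "\<rho> u = \<rho> v"
    have "\<not> \<omega> u < \<omega> v" "\<not> \<omega> v < \<omega> u"
      using iff[OF uv(1,2)] iff[OF uv(2,1)] uv(3) by auto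
    then have "\<omega> u = \<omega> v" by linarith
    from inj_onD[OF inj this uv(1,2)] show "u = v" .
  qed
  moreover have "\<rho> ` T \<subseteq> {1..card T}"
  proof (rule image_subsetI)
    fix u assume "u \<in> T"
    then have "{v \<in> T. \<omega> v \<le> \<omega> u} \<noteq> {}" by auto
    then have "0 < \<rho> u" unfolding \<rho>_def using T by (simp add: card_gt_0_iff)
    moreover have "\<rho> u \<le> card T" unfolding \<rho>_def using T by (intro card_mono) auto
    ultimately show "\<rho> u \<in> {1..card T}" by simp
  qed
  ultimately have "bij_betw \<rho> T {1..card T}"
    using card_subset_eq[of "{1..card T}" "\<rho> ` T"] by (simp add: bij_betw_def card_image)
  then show thesis by (rule that) (rule iff)
qed

text \<open>
  Averaging over all permutations of the nodes turns the labels \<open>\<omega>\<close>, which are almost surely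
  distinct, into a uniformly random labelling, whatever the value of \<open>\<omega>\<close>.
\<close>

lemma expectation_random_labelling:
  fixes g :: "real \<Rightarrow> real" and C :: "'a list list set"
  assumes T: "finite T" and C: "finite C" "\<And>us. us \<in> C \<Longrightarrow> set us \<subseteq> T"
    and [measurable]: "g \<in> borel_measurable borel"
  shows "(\<integral>\<pi>. g (occurrences \<alpha> C \<pi>) \<partial>measure_pmf (random_labelling T)) =
    (\<integral>\<omega>. g (occurrences \<alpha> C \<omega>) \<partial>iid T)"
proof -
  interpret P: prob_space "iid T" by (rule prob_space_iid)
  note [measurable] = occurrences_measurable[OF C(2)]
  define h where "h = (\<lambda>\<omega> :: 'a list \<Rightarrow> real. g (occurrences \<alpha> C \<omega>))"
  have h_meas [measurable]: "h \<in> borel_measurable (iid T)" unfolding h_def by measurable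
  define Z where "Z = (\<Sum>\<pi>\<in>labellings T. g (occurrences \<alpha> C \<pi>))"
  \<comment> \<open>The count is a natural number at most \<open>card C\<close>, so \<open>g\<close>
    is evaluated at finitely many points only. Every measurable \<open>g\<close> is therefore
    bounded where it matters, which gives integrability.\<close>
  define B where "B = Max ((\<lambda>n::nat. \<bar>g n\<bar>) ` {..card C})"
  have perm_bound: "\<bar>h \<omega>\<bar> \<le> B" for \<omega>
  proof -
    have "occurrences \<alpha> C \<omega> = real (card {us \<in> C. same_order (map \<omega> us) \<alpha>})"
      using C(1) unfolding occurrences_def by (subst sum_of_bool_eq) (auto simp: Int_def)
    moreover have "card {us \<in> C. same_order (map \<omega> us) \<alpha>} \<le> card C"
      using C(1) by (intro card_mono) auto
    ultimately show ?thesis unfolding h_def B_def by (auto intro!: Max_ge)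
  qed
  define sh where "sh = (\<lambda>\<sigma> (\<omega> :: 'a list \<Rightarrow> real). \<lambda>n\<in>T. \<omega> (\<sigma> n))"
  have sh_meas [measurable]: "sh \<sigma> \<in> measurable (iid T) (iid T)" if "\<sigma> permutes T" for \<sigma>
    unfolding sh_def
  proof (rule measurable_restrict)
    fix n assume "n \<in> T"
    then have "\<sigma> n \<in> T" using permutes_in_image[OF that] by simp
    then show "(\<lambda>\<omega>. \<omega> (\<sigma> n)) \<in> measurable (iid T) unif"
      by (rule measurable_component_singleton)
  qed
  \<comment> \<open>Independent identically distributed labels are exchangeable, so every
    permutation contributes the same integral.\<close>
  have h_sh: "(\<integral>\<omega>. h (sh \<sigma> \<omega>) \<partial>iid T) = integral\<^sup>L (iid T) h" if \<sigma>: "\<sigma> permutes T" for \<sigma>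
  proof -
    have "distr (iid T) (iid T) (sh \<sigma>) = iid T"
      unfolding sh_def
      using permutes_inj_on[OF \<sigma>] permutes_in_image[OF \<sigma>]
      by (intro distr_PiM_reindex[of T "\<lambda>_. unif" \<sigma> T] prob_space_unif) auto
    then have "integral\<^sup>L (iid T) h = integral\<^sup>L (distr (iid T) (iid T) (sh \<sigma>)) h" by simp
    also have "\<dots> = (\<integral>\<omega>. h (sh \<sigma> \<omega>) \<partial>iid T)"
      using sh_meas[OF \<sigma>] by (intro integral_distr) auto
    finally show ?thesis by simp
  qed
  have "AE \<omega> in iid T. (\<Sum>\<sigma> | \<sigma> permutes T. h (sh \<sigma> \<omega>)) = Z"
    using AE_iid_inj_on[OF T]
  proof eventually_elim
    case (elim \<omega>)
    obtain \<rho> where \<rho>: "bij_betw \<rho> T {1..card T}" "\<And>u v. u \<in> T \<Longrightarrow> v \<in> T \<Longrightarrow> \<rho> u < \<rho> v \<longleftrightarrow> \<omega> u < \<omega> v"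
      using order_preserving_labelling[OF T elim] by blast
    have "Z = (\<Sum>\<sigma> | \<sigma> permutes T. g (occurrences \<alpha> C (restrict (\<rho> \<circ> \<sigma>) T)))"
      unfolding Z_def
      by (rule sum.reindex_bij_betw[OF bij_betw_permutations_labellings[OF T \<rho>(1)], symmetric])
    also have "\<dots> = (\<Sum>\<sigma> | \<sigma> permutes T. h (sh \<sigma> \<omega>))"
      unfolding h_def sh_def
    proof (intro sum.cong refl arg_cong[where f = g] occurrences_cong)
      fix \<sigma> us u v
      assume \<sigma>: "\<sigma> \<in> {\<sigma>. \<sigma> permutes T}" and us: "us \<in> C" "u \<in> set us" "v \<in> set us"
      have "u \<in> T" "v \<in> T" using C(2) us by auto
      moreover from this have "\<sigma> u \<in> T" "\<sigma> v \<in> T" using \<sigma> by (simp_all add: permutes_in_image)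
      ultimately show "restrict (\<rho> \<circ> \<sigma>) T u < restrict (\<rho> \<circ> \<sigma>) T v \<longleftrightarrow>
          (\<lambda>n\<in>T. \<omega> (\<sigma> n)) u < (\<lambda>n\<in>T. \<omega> (\<sigma> n)) v"
        using \<rho>(2) by simp
    qed
    finally show ?case by simp
  qed
  then have "(\<integral>\<omega>. (\<Sum>\<sigma> | \<sigma> permutes T. h (sh \<sigma> \<omega>)) \<partial>iid T) = (\<integral>\<omega>. Z \<partial>iid T)"
    by (intro integral_cong_AE borel_measurable_sum measurable_compose[OF sh_meas h_meas]) auto
  also have "\<dots> = Z" by (simp add: P.prob_space)
  also have "(\<integral>\<omega>. (\<Sum>\<sigma> | \<sigma> permutes T. h (sh \<sigma> \<omega>)) \<partial>iid T) =
      (\<Sum>\<sigma> | \<sigma> permutes T. (\<integral>\<omega>. h (sh \<sigma> \<omega>) \<partial>iid T))"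
    using perm_bound
    by (intro Bochner_Integration.integral_sum P.integrable_const_bound[where B = B] AE_I2
        measurable_compose[OF sh_meas h_meas]) auto
  also have "\<dots> = fact (card T) * integral\<^sup>L (iid T) h"
    using card_permutations[OF refl T] by (simp add: h_sh)
  finally have "fact (card T) * integral\<^sup>L (iid T) h = Z" .
  moreover have "(\<integral>\<pi>. g (occurrences \<alpha> C \<pi>) \<partial>measure_pmf (random_labelling T)) = Z / fact (card T)"
    unfolding random_labelling_def Z_def
    by (subst integral_pmf_of_set) (simp_all add: finite_labellings labellings_nonempty card_labellings T)
  ultimately show ?thesis unfolding h_def by (metis fact_nonzero nonzero_mult_div_cancel_left)
qed

section \<open>Counting chains\<close>

lemma finite_complete_binary_tree [simp]: "finite (complete_binary_tree m)"
  using rooted_tree_complete_binary_tree by (auto simp: rooted_tree_def)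

lemma sum_complete_binary_tree:
  fixes \<phi> :: "nat \<Rightarrow> 'b::comm_semiring_1"
  shows "(\<Sum>v\<in>complete_binary_tree m. \<phi> (length v)) = (\<Sum>d\<le>m. 2 ^ d * \<phi> d)"
proof -
  have card: "card {v :: bool list. length v = d} = 2 ^ d" for d
    using card_lists_length_eq[of "UNIV :: bool set" d] by simp
  have fin: "finite {v :: bool list. length v = d}" for d
    using finite_lists_length_eq[of "UNIV :: bool set" d] by simp
  have "complete_binary_tree m = (\<Union>d\<le>m. {v. length v = d})"
    by (auto simp: complete_binary_tree_def)
  then have "(\<Sum>v\<in>complete_binary_tree m. \<phi> (length v)) =
      (\<Sum>d\<le>m. \<Sum>v\<in>{v :: bool list. length v = d}. \<phi> (length v))"
    using fin by (simp only:) (subst sum.UNION_disjoint, auto)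
  also have "\<dots> = (\<Sum>d\<le>m. \<Sum>v\<in>{v :: bool list. length v = d}. \<phi> d)"
    by (intro sum.cong) auto
  finally show ?thesis using card by simp
qed

text \<open>The descendants of \<open>u\<close> form a complete binary tree of height
  \<open>m - length u\<close>, so they are the fraction \<open>1 / 2 ^ length u\<close> of each
  level from \<open>length u\<close> on. In this form the numerator is a tail of the level sum of
  the whole tree.\<close>

lemma sum_descendants:
  fixes \<phi> :: "nat \<Rightarrow> real"
  assumes "u \<in> complete_binary_tree m"
  shows "(\<Sum>v | v \<in> complete_binary_tree m \<and> prefix u v. \<phi> (length v)) =
    (\<Sum>d=length u..m. 2 ^ d * \<phi> d) / 2 ^ length u"
proof -
  define j where "j = length u"
  have j: "j \<le> m" using assms by (simp add: complete_binary_tree_def j_def)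
  have "{v \<in> complete_binary_tree m. prefix u v} = (\<lambda>w. u @ w) ` complete_binary_tree (m - j)"
    using j by (auto simp: complete_binary_tree_def prefix_def j_def)
  then have "(\<Sum>v | v \<in> complete_binary_tree m \<and> prefix u v. \<phi> (length v)) =
      (\<Sum>w\<in>complete_binary_tree (m - j). \<phi> (j + length w))"
    by (simp add: sum.reindex inj_on_def j_def)
  also have "\<dots> = (\<Sum>d\<le>m - j. 2 ^ d * \<phi> (j + d))"
    by (rule sum_complete_binary_tree)
  also have "\<dots> = (\<Sum>d\<le>m - j. 2 ^ (j + d) * \<phi> (j + d)) / 2 ^ j"
    by (simp add: sum_divide_distrib power_add)
  also have "(\<Sum>d\<le>m - j. 2 ^ (j + d) * \<phi> (j + d)) = (\<Sum>d=j..m. 2 ^ d * \<phi> d)"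
    using j by (intro sum.reindex_bij_witness[of _ "\<lambda>d. d - j" "\<lambda>d. j + d"]) auto
  finally show ?thesis by (simp add: j_def)
qed

section \<open>Asymptotics of the level sums; \<open>level_sum (k - 2) m\<close> is the
  \<open>s\<close> of the overview\<close>

definition level_sum :: "nat \<Rightarrow> nat \<Rightarrow> real" where
  "level_sum q m = (\<Sum>d\<le>m. 2 ^ d * real (d choose q))"

lemma level_sum_nonneg: "level_sum q m \<ge> 0"
  by (simp add: level_sum_def sum_nonneg)

lemma level_sum_Suc: "level_sum q (Suc m) = level_sum q m + 2 ^ Suc m * real (Suc m choose q)"
  by (simp add: level_sum_def)

lemma level_sum_ge: "m \<ge> q \<Longrightarrow> level_sum q m \<ge> 2 ^ m"
proof -
  assume "m \<ge> q"
  then have "1 \<le> real (m choose q)" by (simp add: Suc_le_eq)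
  then have "2 ^ m * 1 \<le> 2 ^ m * real (m choose q)" by (intro mult_left_mono) auto
  also have "\<dots> \<le> level_sum q m"
    unfolding level_sum_def by (intro member_le_sum) auto
  finally show ?thesis by simp
qed

lemma level_sum_pos: "m \<ge> q \<Longrightarrow> level_sum q m > 0"
  by (rule less_le_trans[OF _ level_sum_ge]) auto

lemma filterlim_level_sum: "filterlim (level_sum q) at_top at_top"
proof (rule filterlim_at_top_mono)
  show "filterlim (\<lambda>m. 2 ^ m :: real) at_top at_top"
    by (rule filterlim_at_infinity_imp_filterlim_at_top[OF filterlim_realpow_sequentially_gt1]) auto
  show "\<forall>\<^sub>F m in sequentially. 2 ^ m \<le> level_sum q m"
    using eventually_ge_at_top[of q] by eventually_elim (rule level_sum_ge)
qed

lemma level_sum_le: "level_sum q m \<le> 2 ^ Suc m * real (m choose q)"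
proof -
  have "level_sum q m \<le> (\<Sum>d\<le>m. 2 ^ d * real (m choose q))"
    unfolding level_sum_def by (intro sum_mono mult_left_mono of_nat_mono binomial_right_mono) auto
  also have "\<dots> = (\<Sum>d<Suc m. 2 ^ d) * real (m choose q)"
    by (simp add: sum_distrib_right lessThan_Suc_atMost)
  also have "\<dots> \<le> 2 ^ Suc m * real (m choose q)"
    by (intro mult_right_mono) (simp_all add: geometric_sum)
  finally show ?thesis .
qed

text \<open>Pascal's rule gives the recursion \<open>rec\<close>: one more level doubles the sum up
  to an error \<open>2 * level_sum p m\<close>, and lowering the binomial index by one loses a
  factor of order \<open>m\<close>. For \<open>q = 0\<close> the sums are geometric and the error is
  1.\<close>

lemma level_sum_ratio: "(\<lambda>m. 2 * level_sum q m / level_sum q (Suc m)) \<longlonglongrightarrow> 1"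
proof (cases q)
  case 0
  have "level_sum 0 (Suc m) = 2 * level_sum 0 m + 1" for m
    by (induction m) (simp_all add: level_sum_Suc, simp add: level_sum_def)
  then have *: "2 * level_sum 0 m / level_sum 0 (Suc m) = 1 - 1 / level_sum 0 (Suc m)" for m
    using level_sum_pos[of 0 "Suc m"] by (simp add: field_simps)
  have "filterlim (\<lambda>m. level_sum 0 (Suc m)) at_top at_top"
    using filterlim_level_sum filterlim_Suc by (rule filterlim_compose)
  then have "(\<lambda>m. 1 / level_sum 0 (Suc m)) \<longlonglongrightarrow> 0"
    by (intro tendsto_divide_0[OF tendsto_const] filterlim_at_top_imp_at_infinity)
  then have "(\<lambda>m. 1 - 1 / level_sum 0 (Suc m)) \<longlonglongrightarrow> 1 - 0"
    by (intro tendsto_diff tendsto_const)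
  then show ?thesis unfolding 0 * by simp
next
  case (Suc p)
  have rec: "level_sum (Suc p) (Suc m) = 2 * level_sum (Suc p) m + 2 * level_sum p m" for m
    by (induction m) (simp_all add: level_sum_Suc algebra_simps, simp add: level_sum_def)
  have small: "(\<lambda>m. level_sum p m / level_sum (Suc p) (Suc m)) \<longlonglongrightarrow> 0"
  proof (rule tendsto_sandwich[OF _ _ tendsto_const])
    show "\<forall>\<^sub>F m in sequentially. 0 \<le> level_sum p m / level_sum (Suc p) (Suc m)"
      by (intro always_eventually allI divide_nonneg_nonneg level_sum_nonneg)
    show "\<forall>\<^sub>F m in sequentially. level_sum p m / level_sum (Suc p) (Suc m) \<le> real (Suc p) / real (Suc m)"
      using eventually_ge_at_top[of p]
    proof eventually_elim
      case (elim m)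
      \<comment> \<open>Absorption, \<open>(p + 1) * C(m + 1, p + 1) = (m + 1) * C(m, p)\<close>,
        turns the upper bound for \<open>level_sum p m\<close> into \<open>p + 1\<close> times the
        last term of \<open>level_sum (Suc p) (Suc m)\<close>.\<close>
      have "level_sum p m * real (Suc m) \<le> 2 ^ Suc m * real (m choose p) * real (Suc m)"
        by (intro mult_right_mono level_sum_le) auto
      also have "\<dots> = 2 ^ Suc m * (real (Suc p) * real (Suc m choose Suc p))"
      proof -
        have "real (Suc p) * real (Suc m choose Suc p) = real (Suc m) * real (m choose p)"
          using Suc_times_binomial[of p m] by (metis of_nat_mult)
        then show ?thesis by (simp only: mult_ac)
      qed
      also have "\<dots> \<le> real (Suc p) * level_sum (Suc p) (Suc m)"
        using level_sum_nonneg[of "Suc p" m] by (simp add: level_sum_Suc[of "Suc p"] algebra_simps)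
      finally show ?case
        using level_sum_pos[of "Suc p" "Suc m"] elim by (simp add: field_simps)
    qed
    show "(\<lambda>m. real (Suc p) / real (Suc m)) \<longlonglongrightarrow> 0"
      by (rule LIMSEQ_Suc[OF lim_const_over_n])
  qed
  have "(\<lambda>m. 1 - 2 * (level_sum p m / level_sum (Suc p) (Suc m))) \<longlonglongrightarrow> 1 - 2 * 0"
    by (intro tendsto_intros small)
  moreover have "\<forall>\<^sub>F m in sequentially. 1 - 2 * (level_sum p m / level_sum (Suc p) (Suc m)) =
      2 * level_sum (Suc p) m / level_sum (Suc p) (Suc m)"
    using eventually_ge_at_top[of p]
  proof eventually_elim
    case (elim m)
    then have "level_sum (Suc p) (Suc m) \<noteq> 0" using level_sum_pos[of "Suc p" "Suc m"] by simp
    then have "1 - 2 * (level_sum p m / level_sum (Suc p) (Suc m)) =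
        (level_sum (Suc p) (Suc m) - 2 * level_sum p m) / level_sum (Suc p) (Suc m)"
      by (simp add: diff_divide_distrib)
    then show ?case by (simp add: rec)
  qed
  ultimately show ?thesis unfolding Suc using Lim_transform_eventually by fastforce
qed

text \<open>Iterates the ratio of consecutive sums. With \<open>i = J + 1\<close> it shows that
  lengthening all depths by the height of the top part is asymptotically immaterial, which makes the
  defect vanish.\<close>

lemma level_sum_shift: "(\<lambda>m. 2 ^ i * level_sum q (m - i) / level_sum q m) \<longlonglongrightarrow> 1"
proof (induction i)
  case 0
  have "\<forall>\<^sub>F m in sequentially. 1 = 2 ^ 0 * level_sum q (m - 0) / level_sum q m"
    using eventually_ge_at_top[of q] by eventually_elim (use level_sum_pos in \<open>force\<close>)
  then show ?case by (rule Lim_transform_eventually[OF tendsto_const])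
next
  case (Suc i)
  have "(\<lambda>m. (2 ^ i * level_sum q (m - i) / level_sum q m) * (2 * level_sum q m / level_sum q (Suc m))) \<longlonglongrightarrow> 1 * 1"
    by (intro tendsto_mult Suc.IH level_sum_ratio)
  moreover have "\<forall>\<^sub>F m in sequentially.
      (2 ^ i * level_sum q (m - i) / level_sum q m) * (2 * level_sum q m / level_sum q (Suc m)) =
      2 ^ Suc i * level_sum q (Suc m - Suc i) / level_sum q (Suc m)"
    using eventually_ge_at_top[of q]
    by eventually_elim (use level_sum_pos[of q] in \<open>force simp: field_simps\<close>)
  ultimately have "(\<lambda>m. 2 ^ Suc i * level_sum q (Suc m - Suc i) / level_sum q (Suc m)) \<longlonglongrightarrow> 1"
    using Lim_transform_eventually by fastforce
  then show ?case by (rule LIMSEQ_imp_Suc)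
qed

text \<open>The omitted levels contribute a constant, while the full sum is unbounded.\<close>

lemma level_sum_tail: "(\<lambda>m. (\<Sum>d=j..m. 2 ^ d * real (d choose q)) / level_sum q m) \<longlonglongrightarrow> 1"
proof -
  define c where "c = (\<Sum>d<j. 2 ^ d * real (d choose q))"
  have "(\<lambda>m. 1 - c / level_sum q m) \<longlonglongrightarrow> 1 - 0"
    by (intro tendsto_diff tendsto_const tendsto_divide_0[OF tendsto_const]
        filterlim_at_top_imp_at_infinity filterlim_level_sum)
  moreover have "\<forall>\<^sub>F m in sequentially. 1 - c / level_sum q m =
      (\<Sum>d=j..m. 2 ^ d * real (d choose q)) / level_sum q m"
    using eventually_ge_at_top[of q] eventually_ge_at_top[of j]
  proof eventually_elim
    case (elim m)
    have "{..m} = {..<j} \<union> {j..m}" using elim by auto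
    then have "level_sum q m = c + (\<Sum>d=j..m. 2 ^ d * real (d choose q))"
      unfolding level_sum_def c_def by (simp add: sum.union_disjoint ivl_disj_int)
    moreover have "level_sum q m > 0" using elim level_sum_pos by simp
    ultimately show ?case by (simp add: field_simps)
  qed
  ultimately show ?thesis using Lim_transform_eventually by fastforce
qed

lemma level_sum_tail_le: "(\<Sum>d=j..m. 2 ^ d * real (d choose q)) \<le> level_sum q m"
  unfolding level_sum_def by (intro sum_mono2) auto

subsection \<open>The normalising sum\<close>

lemma sum_prod_lists:
  fixes g :: "'b \<Rightarrow> 'c::comm_semiring_1"
  assumes S: "finite S"
  shows "(\<Sum>vs | length vs = r \<and> set vs \<subseteq> S. \<Prod>i<r. g (vs ! i)) = (\<Sum>v\<in>S. g v) ^ r"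
proof (induction r)
  case (Suc r)
  have "{vs. length vs = Suc r \<and> set vs \<subseteq> S} =
      (\<lambda>(v, vs). v # vs) ` (S \<times> {vs. length vs = r \<and> set vs \<subseteq> S})"
    by (force simp: length_Suc_conv)
  moreover have "inj_on (\<lambda>(v, vs). v # vs) X" for X :: "('b \<times> 'b list) set"
    by (auto simp: inj_on_def)
  ultimately have "(\<Sum>vs | length vs = Suc r \<and> set vs \<subseteq> S. \<Prod>i<Suc r. g (vs ! i)) =
      (\<Sum>(v, vs)\<in>S \<times> {vs. length vs = r \<and> set vs \<subseteq> S}. \<Prod>i<Suc r. g ((v # vs) ! i))"
    by (simp only: sum.reindex comp_def case_prod_unfold)
  also have "\<dots> = (\<Sum>v\<in>S. \<Sum>vs | length vs = r \<and> set vs \<subseteq> S. g v * (\<Prod>i<r. g (vs ! i)))"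
    by (simp only: sum.cartesian_product prod.lessThan_Suc_shift nth_Cons_0 nth_Cons_Suc)
  also have "\<dots> = (\<Sum>v\<in>S. g v) ^ Suc r"
    by (simp add: Suc.IH sum_distrib_left[symmetric] sum_distrib_right)
  finally show ?case .
next
  case 0
  have "{vs. length vs = 0 \<and> set vs \<subseteq> S} = {[]}" by auto
  then show ?case by simp
qed

text \<open>Double counting: if the common ancestor \<open>u\<close> is chosen first, the
  \<open>r\<close> nodes are chosen independently among its descendants, so the inner sum factors
  into a power.\<close>

lemma Upsilon_eq_sum_power:
  assumes "finite T"
  shows "Upsilon r k T = (\<Sum>u\<in>T. (\<Sum>v | v \<in> T \<and> prefix u v. length v choose (k - 2)) ^ r)"
proof -
  have "Upsilon r k T = (\<Sum>vs | length vs = r \<and> set vs \<subseteq> T. \<Sum>u | u \<in> T \<and> (\<forall>v\<in>set vs. prefix u v).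
      \<Prod>i<r. length (vs ! i) choose (k - 2))"
    by (simp add: Upsilon_def common_ancestors_def depth_def)
  also have "\<dots> = (\<Sum>u\<in>T. \<Sum>vs | vs \<in> {vs. length vs = r \<and> set vs \<subseteq> T} \<and> (\<forall>v\<in>set vs. prefix u v).
      \<Prod>i<r. length (vs ! i) choose (k - 2))"
    using assms finite_lists_length_eq[OF assms, of r]
    by (intro sum.swap_restrict) (auto simp: conj_commute)
  also have "\<dots> = (\<Sum>u\<in>T. \<Sum>vs | length vs = r \<and> set vs \<subseteq> {v \<in> T. prefix u v}.
      \<Prod>i<r. length (vs ! i) choose (k - 2))"
    by (intro sum.cong refl arg_cong[where f = "sum _"]) auto
  also have "\<dots> = (\<Sum>u\<in>T. (\<Sum>v | v \<in> T \<and> prefix u v. length v choose (k - 2)) ^ r)"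
    using assms by (simp add: sum_prod_lists[where g = "\<lambda>v. length v choose (k - 2)"])
  finally show ?thesis .
qed

text \<open>After division by \<open>s^r\<close>, level \<open>j\<close> contributes a term that
  tends to \<open>2 ^ j * (1 / 2 ^ j) ^ r\<close>. For \<open>r \<ge> 2\<close> this is at most
  \<open>(1 / 2) ^ j\<close>, which also dominates the terms for finite \<open>m\<close>, so the
  limit may be taken termwise.\<close>

lemma Upsilon_asymp:
  assumes r: "r \<ge> 2"
  obtains c where "c > 0"
    "(\<lambda>m. real (Upsilon r k (complete_binary_tree m)) / level_sum (k - 2) m ^ r) \<longlonglongrightarrow> c"
proof -
  define q where "q = k - 2"
  define t where "t = (\<lambda>j m. \<Sum>d=j..m. 2 ^ d * real (d choose q))"
  \<comment> \<open>Extending by zero beyond level \<open>m\<close> makes the finite sum a series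
    over all \<open>j\<close>, the shape required for dominated convergence.\<close>
  define a where "a = (\<lambda>j m. if j \<le> m then 2 ^ j * (t j m / level_sum q m / 2 ^ j) ^ r else 0)"
  define b where "b = (\<lambda>j::nat. 2 ^ j * (1 / 2 ^ j) ^ r :: real)"
  have t: "0 \<le> t j m" "t j m \<le> level_sum q m" for j m
    using level_sum_tail_le by (auto simp: t_def sum_nonneg)
  have b_le: "b j \<le> (1 / 2) ^ j" for j
  proof -
    have "(1 / 2 ^ j :: real) ^ r \<le> (1 / 2 ^ j) ^ 2" using r by (intro power_decreasing) auto
    then have "b j \<le> 2 ^ j * (1 / 2 ^ j) ^ 2" unfolding b_def by (intro mult_left_mono) auto
    also have "\<dots> = (1 / 2) ^ j" by (simp add: power2_eq_square power_divide)
    finally show ?thesis .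
  qed
  have lim: "a j \<longlonglongrightarrow> b j" for j
  proof -
    have "(\<lambda>m. 2 ^ j * (t j m / level_sum q m / 2 ^ j) ^ r) \<longlonglongrightarrow> b j"
      unfolding b_def t_def by (intro tendsto_intros level_sum_tail) auto
    moreover have "\<forall>\<^sub>F m in sequentially. 2 ^ j * (t j m / level_sum q m / 2 ^ j) ^ r = a j m"
      using eventually_ge_at_top[of j] by eventually_elim (simp add: a_def)
    ultimately show ?thesis by (rule Lim_transform_eventually)
  qed
  have bound: "norm (a j m) \<le> (1 / 2) ^ j" for j m
  proof -
    have "0 \<le> t j m / level_sum q m" "t j m / level_sum q m \<le> 1"
      using t[of j m] by (auto simp: divide_le_eq_1)
    then have "2 ^ j * (t j m / level_sum q m / 2 ^ j) ^ r \<le> b j"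
      unfolding b_def
      by (intro mult_left_mono power_mono divide_right_mono divide_nonneg_nonneg t level_sum_nonneg) auto
    moreover have "0 \<le> t j m / level_sum q m / 2 ^ j"
      using t(1) level_sum_nonneg by (intro divide_nonneg_nonneg) auto
    ultimately show ?thesis using b_le[of j] by (auto simp: a_def)
  qed
  have summ: "summable (\<lambda>j. (1 / 2) ^ j :: real)" by (rule summable_geometric) simp
  have main: "\<forall>\<^sub>F m in sequentially. summable (\<lambda>j. norm (a j m))" "summable (\<lambda>j. norm (b j))"
    "(\<lambda>m. \<Sum>j. a j m) \<longlonglongrightarrow> (\<Sum>j. b j)"
    using tannerys_theorem[of a b sequentially "\<lambda>j. (1 / 2) ^ j", OF lim always_eventually summ] bound
    by auto
  have "(\<Sum>j. a j m) = real (Upsilon r k (complete_binary_tree m)) / level_sum q m ^ r" for m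
  proof -
    have "real (Upsilon r k (complete_binary_tree m)) =
        (\<Sum>u\<in>complete_binary_tree m. (t (length u) m / 2 ^ length u) ^ r)"
      unfolding Upsilon_eq_sum_power[OF finite_complete_binary_tree] of_nat_sum of_nat_power t_def
        q_def[symmetric]
      by (intro sum.cong refl arg_cong[where f = "\<lambda>x. x ^ r"] sum_descendants)
    also have "\<dots> = (\<Sum>j\<le>m. 2 ^ j * (t j m / 2 ^ j) ^ r)"
      by (rule sum_complete_binary_tree)
    finally have "real (Upsilon r k (complete_binary_tree m)) / level_sum q m ^ r = (\<Sum>j\<le>m. a j m)"
      by (simp add: a_def sum_divide_distrib power_divide power_mult_distrib mult.commute)
    also have "\<dots> = (\<Sum>j. a j m)"
      by (rule suminf_finite[symmetric]) (auto simp: a_def)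
    finally show ?thesis by simp
  qed
  with main(3) have "(\<lambda>m. real (Upsilon r k (complete_binary_tree m)) / level_sum q m ^ r) \<longlonglongrightarrow> (\<Sum>j. b j)"
    by simp
  moreover have "(\<Sum>j. b j) > 0"
    using main(2) by (intro suminf_pos summable_norm_cancel[OF main(2)]) (auto simp: b_def)
  ultimately show thesis using that unfolding q_def by blast
qed

subsection \<open>Chains in terms of the depths of their nodes\<close>

text \<open>A chain is determined by its lowest node \<open>v\<close> and by the set of depths of its other nodes.\<close>

definition chain_of :: "'a list \<times> nat set \<Rightarrow> 'a list list" where
  "chain_of = (\<lambda>(v, D). map (\<lambda>i. take i v) (sorted_list_of_set D) @ [v])"

lemma strict_prefix_take_iff:
  "strict_prefix u v \<longleftrightarrow> length u < length v \<and> u = take (length u) v"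
proof
  assume "strict_prefix u v"
  then show "length u < length v \<and> u = take (length u) v"
    by (auto elim: strict_prefixE')
next
  assume uv: "length u < length v \<and> u = take (length u) v"
  then have "prefix u v" by (metis take_is_prefix)
  with uv show "strict_prefix u v" by (auto simp: prefix_order.less_le)
qed

text \<open>Depths increase strictly along a chain, so sorting them recovers the order of the nodes,
  and each node is the prefix of the lowest one of its length. The last conclusion makes the depth
  set explicit, so that a given node of the chain can be located in it.\<close>

lemma chain_of_surj:
  assumes us: "us \<in> chains k T" and k: "k \<ge> 1"
  obtains D where "D \<subseteq> {..<length (last us)}" "card D = k - 1" "us = chain_of (last us, D)"
    "last us \<in> T" "D = length ` set (butlast us)"
proof -
  define v where "v = last us"
  define ws where "ws = butlast us"
  have "us \<noteq> []" "length us = k" "set us \<subseteq> T" "sorted_wrt strict_prefix us"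
    using us k by (auto simp: chains_def)
  then have us_eq: "us = ws @ [v]" and v: "v \<in> T" and len: "length ws = k - 1"
    by (auto simp: v_def ws_def)
  have srt: "sorted_wrt strict_prefix ws" and below: "\<And>w. w \<in> set ws \<Longrightarrow> strict_prefix w v"
    using \<open>sorted_wrt strict_prefix us\<close> by (auto simp: us_eq sorted_wrt_append)
  have "sorted_wrt (<) (map length ws)"
    unfolding sorted_wrt_map by (rule sorted_wrt_mono_rel[OF _ srt]) (rule prefix_length_less)
  then have sd: "sorted (map length ws)" "distinct (map length ws)"
    by (auto simp: strict_sorted_iff)
  define D where "D = set (map length ws)"
  have D: "sorted_list_of_set D = map length ws"
    unfolding D_def using sd by (metis sorted_list_of_set_sort_remdups distinct_remdups_id sorted_sort_id)
  have "take (length w) v = w" if "w \<in> set ws" for w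
    using below[OF that] unfolding strict_prefix_take_iff by simp
  then have "map (\<lambda>i. take i v) (map length ws) = ws"
    by (simp add: map_idI)
  then have "us = chain_of (v, D)" by (simp add: chain_of_def D us_eq)
  moreover have "D \<subseteq> {..<length v}" using below by (auto simp: D_def dest: prefix_length_less)
  moreover have "card D = k - 1" unfolding D_def distinct_card[OF sd(2)] using len by simp
  ultimately show thesis using that[of D] v by (simp add: v_def ws_def D_def)
qed

lemma chain_of_chains:
  assumes T: "rooted_tree T" and v: "v \<in> T" and D: "D \<subseteq> {..<length v}" "card D = k - 1" and k: "k \<ge> 1"
  shows "chain_of (v, D) \<in> chains k T"
proof -
  have fin: "finite D" using D(1) finite_subset by blast
  have sp: "strict_prefix (take i v) v" if "i \<in> D" for i
    using that D(1) by (auto simp: strict_prefix_take_iff)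
  have "sorted_wrt (\<lambda>i j. strict_prefix (take i v) (take j v)) (sorted_list_of_set D)"
  proof (rule sorted_wrt_mono_rel)
    show "sorted_wrt (<) (sorted_list_of_set D)" by (rule strict_sorted_list_of_set)
    fix i j assume "i \<in> set (sorted_list_of_set D)" "j \<in> set (sorted_list_of_set D)" "i < j"
    then show "strict_prefix (take i v) (take j v)"
      using D(1) fin by (auto simp: strict_prefix_take_iff min_def)
  qed
  then have "sorted_wrt strict_prefix (chain_of (v, D))"
    using sp fin by (auto simp: chain_of_def sorted_wrt_append sorted_wrt_map)
  moreover have "set (chain_of (v, D)) \<subseteq> T"
    using T v fin by (auto simp: chain_of_def rooted_tree_def take_is_prefix)
  moreover have "length (chain_of (v, D)) = k" using D(2) k fin by (simp add: chain_of_def)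
  ultimately show ?thesis by (simp add: chains_def)
qed

lemma finite_chains:
  assumes "finite T"
  shows "finite (chains k T)"
  by (rule finite_subset[OF _ finite_lists_length_eq[OF assms, of k]]) (auto simp: chains_def)

text \<open>The chain shows \<open>v\<close> as its last entry and \<open>D\<close> as the lengths
  of the other entries; \<open>D \<subseteq> {..<length v}\<close> ensures that
  \<open>take i v\<close> really has length \<open>i\<close>.\<close>

lemma inj_on_chain_of: "inj_on chain_of (SIGMA v:T. {D. D \<subseteq> {..<length v} \<and> P v D})"
proof (rule inj_onI, clarsimp)
  fix v w D E assume DE: "D \<subseteq> {..<length v}" "E \<subseteq> {..<length w}" and eq: "chain_of (v, D) = chain_of (w, E)"
  then have vw: "v = w" by (auto simp: chain_of_def)
  have fin: "finite D" "finite E" using DE finite_subset by blast+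
  have *: "map length (butlast (chain_of (v, F))) = sorted_list_of_set F" if "F \<subseteq> {..<length v}" for F
  proof -
    have "finite F" using that finite_subset by blast
    then show ?thesis using that by (auto simp: chain_of_def intro!: map_idI)
  qed
  have "sorted_list_of_set D = sorted_list_of_set E"
    using *[of D] *[of E] DE eq vw by simp
  then show "v = w \<and> D = E" using vw fin by (metis set_sorted_list_of_set)
qed

lemma card_subsets_containing:
  assumes A: "finite A" and a: "a \<in> A" and n: "n \<ge> 1"
  shows "card {D. D \<subseteq> A \<and> card D = n \<and> a \<in> D} = (card A - 1) choose (n - 1)"
proof -
  have "bij_betw (insert a) {D. D \<subseteq> A - {a} \<and> card D = n - 1} {D. D \<subseteq> A \<and> card D = n \<and> a \<in> D}"
  proof (rule bij_betwI[where g = "\<lambda>D. D - {a}"])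
    show "insert a \<in> {D. D \<subseteq> A - {a} \<and> card D = n - 1} \<rightarrow> {D. D \<subseteq> A \<and> card D = n \<and> a \<in> D}"
    proof safe
      fix D assume D: "D \<subseteq> A - {a}" "card D = n - 1"
      then have "finite D" "a \<notin> D" using A finite_subset by blast+
      then show "card (insert a D) = n" using D n by simp
    qed (use a in auto)
    show "(\<lambda>D. D - {a}) \<in> {D. D \<subseteq> A \<and> card D = n \<and> a \<in> D} \<rightarrow> {D. D \<subseteq> A - {a} \<and> card D = n - 1}"
      by auto
  qed auto
  then show ?thesis
    using n_subsets[of "A - {a}" "n - 1"] A a bij_betw_same_card by fastforce
qed

text \<open>When the lowest node \<open>v\<close> is a proper descendant of \<open>u\<close>, the
  depth of \<open>u\<close> is already in the depth set, and the other \<open>k - 2\<close> depths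
  come from the remaining \<open>length v - 1\<close>. The bound is relaxed to
  \<open>length v choose (k - 2)\<close> to match the level sums.\<close>

lemma card_chains_above_last:
  assumes T: "finite T" and k: "k \<ge> 2"
  shows "card {us \<in> chains k T. u \<in> set us \<and> last us \<noteq> u}
    \<le> (\<Sum>v | v \<in> T \<and> strict_prefix u v. length v choose (k - 2))"
proof -
  define X where "X = (SIGMA v:{v \<in> T. strict_prefix u v}.
    {D. D \<subseteq> {..<length v} \<and> card D = k - 1 \<and> length u \<in> D})"
  have fin: "finite X" unfolding X_def using T by (intro finite_SigmaI) auto
  have "{us \<in> chains k T. u \<in> set us \<and> last us \<noteq> u} \<subseteq> chain_of ` X"
  proof safe
    fix us assume us: "us \<in> chains k T" "u \<in> set us" "last us \<noteq> u"
    obtain D where D: "D \<subseteq> {..<length (last us)}" "card D = k - 1" "us = chain_of (last us, D)"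
      "last us \<in> T" "D = length ` set (butlast us)"
      using chain_of_surj[OF us(1)] k by (metis one_le_numeral order_trans)
    have "us \<noteq> []" using us(2) by auto
    then have "us = butlast us @ [last us]" by simp
    moreover from this have bl: "u \<in> set (butlast us)" using us(2,3)
      by (metis Un_iff empty_iff list.set(1) list.set(2) set_append singletonD insert_iff)
    ultimately have "strict_prefix u (last us)"
      using us(1) unfolding chains_def by (metis (mono_tags, lifting) mem_Collect_eq sorted_wrt_append list.set_intros(1))
    then have "(last us, D) \<in> X" using D bl by (auto simp: X_def)
    then show "us \<in> chain_of ` X" using D(3) by (metis image_eqI)
  qed
  then have "card {us \<in> chains k T. u \<in> set us \<and> last us \<noteq> u} \<le> card X"
    using fin by (rule surj_card_le[rotated])
  also have "card X = (\<Sum>v | v \<in> T \<and> strict_prefix u v. (length v - 1) choose (k - 2))"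
  proof -
    have "card {D. D \<subseteq> {..<length v} \<and> card D = k - 1 \<and> length u \<in> D} = (length v - 1) choose (k - 2)"
      if "strict_prefix u v" for v
      using card_subsets_containing[of "{..<length v}" "length u" "k - 1"] that k
      by (simp add: prefix_length_less numeral_2_eq_2)
    then show ?thesis unfolding X_def using T by (subst card_SigmaI) auto
  qed
  also have "\<dots> \<le> (\<Sum>v | v \<in> T \<and> strict_prefix u v. length v choose (k - 2))"
    by (intro sum_mono binomial_right_mono) auto
  finally show ?thesis .
qed

lemma card_chains_last:
  assumes T: "finite T" and k: "k \<ge> 2"
  shows "card {us \<in> chains k T. last us = u} \<le> length u choose (k - 1)"
proof -
  define X where "X = {D. D \<subseteq> {..<length u} \<and> card D = k - 1}"
  have "finite X" unfolding X_def by simp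
  moreover have "{us \<in> chains k T. last us = u} \<subseteq> (\<lambda>D. chain_of (u, D)) ` X"
  proof safe
    fix us assume us: "us \<in> chains k T" "u = last us"
    obtain D where "D \<subseteq> {..<length (last us)}" "card D = k - 1" "us = chain_of (last us, D)"
      using chain_of_surj[OF us(1)] k by (metis one_le_numeral order_trans)
    then show "us \<in> (\<lambda>D. chain_of (last us, D)) ` X" using us(2) by (auto simp: X_def)
  qed
  ultimately have "card {us \<in> chains k T. last us = u} \<le> card X"
    by (rule surj_card_le)
  also have "card X = length u choose (k - 1)"
    unfolding X_def using n_subsets[of "{..<length u}" "k - 1"] by simp
  finally show ?thesis .
qed

text \<open>In the factor \<open>length u + 1\<close>, the 1 accounts for chains that end strictly
  below \<open>u\<close> and \<open>length u\<close> for those that end at \<open>u\<close>.\<close>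

lemma card_chains_through:
  assumes u: "u \<in> complete_binary_tree m" and k: "k \<ge> 2"
  shows "real (card {us \<in> chains k (complete_binary_tree m). u \<in> set us})
    \<le> real (length u + 1) * (level_sum (k - 2) m / 2 ^ length u)"
proof -
  let ?T = "complete_binary_tree m"
  define q where "q = k - 2"
  define D where "D = (\<Sum>v | v \<in> ?T \<and> prefix u v. length v choose q)"
  have fin: "finite (chains k ?T)" by (simp add: finite_chains)
  have "{us \<in> chains k ?T. u \<in> set us} \<subseteq>
      {us \<in> chains k ?T. last us = u} \<union> {us \<in> chains k ?T. u \<in> set us \<and> last us \<noteq> u}" by auto
  then have "card {us \<in> chains k ?T. u \<in> set us} \<le>
      card {us \<in> chains k ?T. last us = u} + card {us \<in> chains k ?T. u \<in> set us \<and> last us \<noteq> u}"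
    using fin by (intro order_trans[OF card_mono card_Un_le]) auto
  also have "\<dots> \<le> (length u choose (k - 1)) + (\<Sum>v | v \<in> ?T \<and> strict_prefix u v. length v choose q)"
    unfolding q_def using k by (intro add_mono card_chains_last card_chains_above_last) auto
  \<comment> \<open>Choosing one more ancestor costs at most a factor \<open>length u\<close>. Then
    both kinds of chains are compared with the same sum \<open>D\<close>, one of whose terms belongs
    to \<open>u\<close> itself.\<close>
  also have "length u choose (k - 1) \<le> length u * (length u choose q)"
  proof -
    have "k - 1 = Suc q" using k by (simp add: q_def)
    moreover have "(length u choose Suc q) * 1 \<le> (length u choose Suc q) * Suc q" by (intro mult_left_mono) auto
    moreover have "(length u choose Suc q) * Suc q = (length u - q) * (length u choose q)"
      by (simp only: mult.commute[of _ "Suc q"] binomial_absorption binomial_absorb_comp)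
    moreover have "(length u - q) * (length u choose q) \<le> length u * (length u choose q)" by simp
    ultimately show ?thesis by (metis mult.right_neutral order_trans)
  qed
  also have "length u choose q \<le> D"
    unfolding D_def using u by (intro member_le_sum[of u]) auto
  also have "(\<Sum>v | v \<in> ?T \<and> strict_prefix u v. length v choose q) \<le> D"
    unfolding D_def by (intro sum_mono2) auto
  finally have "card {us \<in> chains k ?T. u \<in> set us} \<le> (length u + 1) * D" by simp
  then have "real (card {us \<in> chains k ?T. u \<in> set us}) \<le> real (length u + 1) * real D"
    by (metis of_nat_mono of_nat_mult)
  also have "real D \<le> level_sum q m / 2 ^ length u"
    unfolding D_def of_nat_sum using sum_descendants[OF u, of "\<lambda>d. real (d choose q)"]
    by (simp add: level_sum_tail_le divide_right_mono)
  finally show ?thesis by (simp add: q_def mult_left_mono)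
qed

text \<open>A chain of at least two nodes that starts at \<open>u\<close> ends strictly below
  \<open>u\<close>, so the factor \<open>length u + 1\<close> disappears. The resulting bound has
  the exact leading order, as the matching lower bound for jumping chains shows.\<close>

lemma card_chains_from:
  assumes u: "u \<in> complete_binary_tree m" and k: "k \<ge> 2"
  shows "real (card {us \<in> chains k (complete_binary_tree m). hd us = u})
    \<le> level_sum (k - 2) m / 2 ^ length u"
proof -
  let ?T = "complete_binary_tree m"
  have "{us \<in> chains k ?T. hd us = u} \<subseteq> {us \<in> chains k ?T. u \<in> set us \<and> last us \<noteq> u}"
  proof (rule Collect_mono, rule impI)
    fix us assume us: "us \<in> chains k ?T \<and> hd us = u"
    then obtain w ws where w: "us = u # w # ws"
      using k by (auto simp: chains_def numeral_2_eq_2 Suc_le_length_iff)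
    then have "strict_prefix u (last us)" using us by (auto simp: chains_def split: if_splits)
    then show "us \<in> chains k ?T \<and> u \<in> set us \<and> last us \<noteq> u" using us w by auto
  qed
  then have "card {us \<in> chains k ?T. hd us = u} \<le> (\<Sum>v | v \<in> ?T \<and> strict_prefix u v. length v choose (k - 2))"
    using k by (intro order_trans[OF card_mono card_chains_above_last]) (auto simp: finite_chains)
  also have "\<dots> \<le> (\<Sum>v | v \<in> ?T \<and> prefix u v. length v choose (k - 2))"
    by (intro sum_mono2) auto
  finally have "real (card {us \<in> chains k ?T. hd us = u}) \<le>
      real (\<Sum>v | v \<in> ?T \<and> prefix u v. length v choose (k - 2))"
    by (rule of_nat_mono)
  also have "\<dots> = (\<Sum>v | v \<in> ?T \<and> prefix u v. real (length v choose (k - 2)))"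
    by (rule of_nat_sum)
  also have "\<dots> \<le> level_sum (k - 2) m / 2 ^ length u"
    using sum_descendants[OF u, of "\<lambda>d. real (d choose (k - 2))"]
    by (simp add: level_sum_tail_le divide_right_mono)
  finally show ?thesis .
qed

text \<open>Chains are built from \<open>u\<close>, a descendant \<open>v\<close> deeper than
  \<open>J\<close>, and \<open>k - 2\<close> depths strictly between \<open>J\<close> and the depth
  of \<open>v\<close>. Such choices give distinct chains that meet the top part in \<open>u\<close>
  only.\<close>

lemma card_chains_jumping:
  assumes u: "u \<in> complete_binary_tree J" and J: "J < m" and k: "k \<ge> 2"
  shows "2 ^ (J + 1) * level_sum (k - 2) (m - (J + 1)) / 2 ^ length u \<le>
    real (card {us \<in> chains k (complete_binary_tree m). hd us = u \<and> set (tl us) \<inter> complete_binary_tree J = {}})"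
proof -
  let ?T = "complete_binary_tree m"
  define q where "q = k - 2"
  define j where "j = length u"
  have j: "j \<le> J" using u by (simp add: complete_binary_tree_def j_def)
  define Y where "Y = (SIGMA v:{v \<in> ?T. prefix u v \<and> J < length v}. {D. D \<subseteq> {J<..<length v} \<and> card D = q})"
  \<comment> \<open>A set of intermediate depths is a \<open>q\<close>-subset of the
    \<open>d - (J + 1)\<close> depths strictly between \<open>J\<close> and \<open>d\<close>.
    Shifting by \<open>J + 1\<close> produces the level sum of a tree of height
    \<open>m - (J + 1)\<close>.\<close>
  define \<phi> where "\<phi> = (\<lambda>d. if J < d then real (d - (J + 1) choose q) else 0)"
  have "(\<Sum>d=j..m. 2 ^ d * \<phi> d) = (\<Sum>d=J+1..m. 2 ^ d * real (d - (J + 1) choose q))"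
    using j by (intro sum.mono_neutral_cong_right) (auto simp: \<phi>_def)
  also have "\<dots> = (\<Sum>i\<le>m - (J + 1). 2 ^ (J + 1) * (2 ^ i * real (i choose q)))"
    using J by (intro sum.reindex_bij_witness[of _ "\<lambda>i. i + (J + 1)" "\<lambda>d. d - (J + 1)"])
      (auto simp: mult.assoc[symmetric] simp flip: power_add power_Suc)
  also have "\<dots> = 2 ^ (J + 1) * level_sum q (m - (J + 1))"
    by (simp add: level_sum_def sum_distrib_left)
  finally have "2 ^ (J + 1) * level_sum q (m - (J + 1)) / 2 ^ j = (\<Sum>v | v \<in> ?T \<and> prefix u v. \<phi> (length v))"
    using sum_descendants[of u m \<phi>] u J by (simp add: j_def complete_binary_tree_def)
  also have "\<dots> = (\<Sum>v | v \<in> ?T \<and> prefix u v \<and> J < length v. real (length v - (J + 1) choose q))"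
    by (intro sum.mono_neutral_cong_right) (auto simp: \<phi>_def)
  also have "\<dots> = real (card Y)"
    unfolding Y_def by (subst card_SigmaI) (auto simp: n_subsets)
  also have "card Y \<le> card {us \<in> chains k ?T. hd us = u \<and> set (tl us) \<inter> complete_binary_tree J = {}}"
  proof (rule card_inj_on_le[where f = "\<lambda>(v, D). chain_of (v, insert j D)"])
    show "inj_on (\<lambda>(v, D). chain_of (v, insert j D)) Y"
    proof -
      have "j \<notin> D" if "(v, D) \<in> Y" for v D
        using that j by (auto simp: Y_def)
      then have "inj_on (\<lambda>(v, D). (v, insert j D)) Y"
        unfolding inj_on_def using insert_ident by fastforce
      moreover have "(\<lambda>(v, D). (v, insert j D)) ` Y \<subseteq> (SIGMA v:?T. {D. D \<subseteq> {..<length v} \<and> True})"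
        using j by (fastforce simp: Y_def)
      ultimately have "inj_on (chain_of \<circ> (\<lambda>(v, D). (v, insert j D))) Y"
        by (intro comp_inj_on inj_on_subset[OF inj_on_chain_of])
      then show ?thesis by (simp add: comp_def case_prod_unfold)
    qed
    show "(\<lambda>(v, D). chain_of (v, insert j D)) ` Y \<subseteq>
        {us \<in> chains k ?T. hd us = u \<and> set (tl us) \<inter> complete_binary_tree J = {}}"
    proof clarify
      fix v D assume "(v, D) \<in> Y"
      then have v: "v \<in> ?T" "prefix u v" "J < length v" and D: "D \<subseteq> {J<..<length v}" "card D = q"
        by (auto simp: Y_def)
      have fin: "finite D" using D(1) finite_subset by blast
      have jD: "j \<notin> D" "\<forall>i\<in>D. j < i" using D(1) j by auto
      have "chain_of (v, insert j D) \<in> chains k ?T"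
        using v D j jD(1) fin k
        by (intro chain_of_chains rooted_tree_complete_binary_tree) (auto simp: q_def)
      \<comment> \<open>As \<open>j\<close> is below all of \<open>D\<close>, the node
        \<open>u\<close> comes first and every later node lies deeper than \<open>J\<close>.\<close>
      moreover have "sorted_list_of_set (insert j D) = j # sorted_list_of_set D"
      proof -
        have "sorted (j # sorted_list_of_set D)" "distinct (j # sorted_list_of_set D)"
          "set (j # sorted_list_of_set D) = insert j D"
          using fin jD by auto
        then show ?thesis by (metis sorted_list_of_set_sort_remdups distinct_remdups_id sorted_sort_id)
      qed
      moreover have "take j v = u" using v(2) by (auto simp: j_def prefix_def)
      ultimately show "chain_of (v, insert j D) \<in> chains k ?T \<and> hd (chain_of (v, insert j D)) = u \<and>
          set (tl (chain_of (v, insert j D))) \<inter> complete_binary_tree J = {}"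
        using fin D(1) v(3) by (auto simp: chain_of_def complete_binary_tree_def)
    qed
  qed (simp add: finite_chains)
  finally show ?thesis by (simp add: q_def j_def)
qed

section \<open>Convergence of the normalised central moments\<close>

text \<open>Each term of the factorisation of \<open>a ^ r - b ^ r\<close> is at most
  \<open>c ^ (r - 1)\<close> for the larger absolute value \<open>c\<close>, and this power is one
  of the two summands on the right.\<close>

lemma abs_power_diff_le:
  fixes a b :: real
  shows "\<bar>a ^ r - b ^ r\<bar> \<le> r * (\<bar>a - b\<bar> * (\<bar>a\<bar> ^ (r - 1) + \<bar>b\<bar> ^ (r - 1)))"
proof -
  define c where "c = max \<bar>a\<bar> \<bar>b\<bar>"
  have "\<bar>\<Sum>i<r. b ^ (r - Suc i) * a ^ i\<bar> \<le> (\<Sum>i<r. c ^ (r - 1))"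
  proof (rule order_trans[OF sum_abs sum_mono])
    fix i assume i: "i \<in> {..<r}"
    have "\<bar>b ^ (r - Suc i) * a ^ i\<bar> \<le> c ^ (r - Suc i) * c ^ i"
      unfolding abs_mult power_abs c_def by (intro mult_mono power_mono) auto
    also have "\<dots> = c ^ (r - 1)" using i by (simp flip: power_add)
    finally show "\<bar>b ^ (r - Suc i) * a ^ i\<bar> \<le> c ^ (r - 1)" .
  qed
  also have "\<dots> \<le> r * (\<bar>a\<bar> ^ (r - 1) + \<bar>b\<bar> ^ (r - 1))"
    by (auto simp: c_def max_def intro!: mult_left_mono)
  finally have "\<bar>a - b\<bar> * \<bar>\<Sum>i<r. b ^ (r - Suc i) * a ^ i\<bar> \<le> \<bar>a - b\<bar> * (r * (\<bar>a\<bar> ^ (r - 1) + \<bar>b\<bar> ^ (r - 1)))"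
    by (intro mult_left_mono) auto
  then show ?thesis
    by (simp add: power_diff_sumr2 abs_mult mult_ac)
qed

text \<open>Mean square closeness plus bounds on higher moments gives closeness of the moments of
  order \<open>r\<close>. Young's inequality with a free weight \<epsilon> is used in the role of
  Cauchy-Schwarz. The bound \<open>B\<close> serves integrability and does not enter the estimate,
  so it may grow with the tree.\<close>

lemma (in prob_space) moment_diff_le:
  fixes a b :: "'a \<Rightarrow> real"
  assumes [measurable]: "random_variable borel a" "random_variable borel b"
    and bound: "\<And>x. x \<in> space M \<Longrightarrow> \<bar>a x\<bar> \<le> B" "\<And>x. x \<in> space M \<Longrightarrow> \<bar>b x\<bar> \<le> B"
    and \<epsilon>: "\<epsilon> > 0"
  shows "\<bar>expectation (\<lambda>x. a x ^ r) - expectation (\<lambda>x. b x ^ r)\<bar> \<le>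
    r * (expectation (\<lambda>x. (a x - b x)\<^sup>2) / (2 * \<epsilon>)
      + \<epsilon> * (expectation (\<lambda>x. \<bar>a x\<bar> ^ (2 * (r - 1))) + expectation (\<lambda>x. \<bar>b x\<bar> ^ (2 * (r - 1)))))"
proof -
  have pow_bound: "\<bar>t\<bar> ^ n \<le> B ^ n" if "\<bar>t\<bar> \<le> B" for t n
    using that by (intro power_mono) auto
  have int: "integrable M (\<lambda>x. a x ^ n)" "integrable M (\<lambda>x. b x ^ n)"
    "integrable M (\<lambda>x. \<bar>a x\<bar> ^ n)" "integrable M (\<lambda>x. \<bar>b x\<bar> ^ n)" for n
    using bound pow_bound
    by (intro integrable_const_bound[where B = "B ^ n"] AE_I2; simp add: power_abs)+
  have int2: "integrable M (\<lambda>x. (a x - b x)\<^sup>2)"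
  proof (intro integrable_const_bound[where B = "(2 * B)\<^sup>2"] AE_I2)
    fix x assume "x \<in> space M"
    then have "\<bar>a x - b x\<bar> \<le> 2 * B" using bound[of x] by linarith
    then have "\<bar>a x - b x\<bar>\<^sup>2 \<le> (2 * B)\<^sup>2" by (intro power_mono) auto
    then show "norm ((a x - b x)\<^sup>2) \<le> (2 * B)\<^sup>2" by simp
  qed measurable
  have pw: "\<bar>a x ^ r - b x ^ r\<bar> \<le> r * ((a x - b x)\<^sup>2 / (2 * \<epsilon>)
      + \<epsilon> * (\<bar>a x\<bar> ^ (2 * (r - 1)) + \<bar>b x\<bar> ^ (2 * (r - 1))))" for x
  proof -
    define d where "d = \<bar>a x - b x\<bar>"
    define u where "u = \<bar>a x\<bar> ^ (r - 1)"
    define v where "v = \<bar>b x\<bar> ^ (r - 1)"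
    \<comment> \<open>Expanding this square yields
      \<open>d * w \<le> d^2 / (2 * \<epsilon>) + \<epsilon> * w^2 / 2\<close> for
      \<open>w = u + v\<close>.\<close>
    have "0 \<le> (d / \<epsilon> - (u + v))\<^sup>2" by simp
    then have "0 \<le> \<epsilon> / 2 * (d / \<epsilon> - (u + v))\<^sup>2" using \<epsilon> by simp
    also have "\<dots> = d\<^sup>2 / (2 * \<epsilon>) - d * (u + v) + \<epsilon> / 2 * (u + v)\<^sup>2"
      using \<epsilon> by (simp add: power2_eq_square field_simps)
    finally have "d * (u + v) \<le> d\<^sup>2 / (2 * \<epsilon>) + \<epsilon> / 2 * (u + v)\<^sup>2" by simp
    moreover have "\<epsilon> / 2 * (u + v)\<^sup>2 \<le> \<epsilon> / 2 * (2 * u\<^sup>2 + 2 * v\<^sup>2)"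
      using \<epsilon> sum_squares_bound[of u v] by (intro mult_left_mono) (auto simp: power2_sum)
    ultimately have "d * (u + v) \<le> d\<^sup>2 / (2 * \<epsilon>) + \<epsilon> * (u\<^sup>2 + v\<^sup>2)" by (simp add: algebra_simps)
    then have "r * (d * (u + v)) \<le> r * (d\<^sup>2 / (2 * \<epsilon>) + \<epsilon> * (u\<^sup>2 + v\<^sup>2))"
      by (intro mult_left_mono) auto
    then show ?thesis
      using abs_power_diff_le[of "a x" r "b x"]
      by (simp add: d_def u_def v_def power_mult[symmetric] mult.commute)
  qed
  have "\<bar>expectation (\<lambda>x. a x ^ r) - expectation (\<lambda>x. b x ^ r)\<bar> = \<bar>expectation (\<lambda>x. a x ^ r - b x ^ r)\<bar>"
    using int by simp
  also have "\<dots> \<le> expectation (\<lambda>x. \<bar>a x ^ r - b x ^ r\<bar>)"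
    using integral_norm_bound[of M "\<lambda>x. a x ^ r - b x ^ r"] by simp
  also have "\<dots> \<le> expectation (\<lambda>x. r * ((a x - b x)\<^sup>2 / (2 * \<epsilon>)
      + \<epsilon> * (\<bar>a x\<bar> ^ (2 * (r - 1)) + \<bar>b x\<bar> ^ (2 * (r - 1)))))"
    using int int2 pw by (intro integral_mono) auto
  also have "\<dots> = r * (expectation (\<lambda>x. (a x - b x)\<^sup>2) / (2 * \<epsilon>)
      + \<epsilon> * (expectation (\<lambda>x. \<bar>a x\<bar> ^ (2 * (r - 1))) + expectation (\<lambda>x. \<bar>b x\<bar> ^ (2 * (r - 1)))))"
    using int int2 by simp
  finally show ?thesis .
qed

section \<open>Influence of a single label, and its square summability over the tree\<close>

definition influence :: "'b list \<Rightarrow> real" where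
  "influence u = real (length u + 1) / 2 ^ length u"

text \<open>The sum of squared influences over all levels from \<open>n\<close> on:
  \<open>2 ^ d\<close> nodes of depth \<open>d\<close>, each with square
  \<open>(d + 1)^2 / 4 ^ d\<close>.\<close>

definition influence_tail :: "nat \<Rightarrow> real" where
  "influence_tail n = (\<Sum>i. (real (i + n + 1))\<^sup>2 / 2 ^ (i + n))"

lemma summable_influence: "summable (\<lambda>j. (real (j + 1))\<^sup>2 / 2 ^ j)"
proof (rule summable_comparison_test')
  show "summable (\<lambda>j. 16 * (25 / 32) ^ j :: real)"
    by (intro summable_mult summable_geometric) simp
  fix j :: nat
  \<comment> \<open>The base 5/4 is chosen with square below 2, so that squaring and dividing by
    \<open>2 ^ j\<close> leaves the ratio 25/32.\<close>
  have "1 + real j * (1 / 4) \<le> (1 + 1 / 4) ^ j" by (rule Bernoulli_inequality) simp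
  then have "real (j + 1) \<le> 4 * (5 / 4) ^ j" by simp
  then have "(real (j + 1))\<^sup>2 \<le> (4 * (5 / 4) ^ j)\<^sup>2" by (intro power_mono) auto
  also have "\<dots> = 16 * (25 / 16) ^ j"
    by (simp add: power_mult_distrib power2_eq_square flip: power_mult_distrib)
  finally have "(real (j + 1))\<^sup>2 / 2 ^ j \<le> 16 * (25 / 16) ^ j / 2 ^ j"
    by (intro divide_right_mono) auto
  also have "\<dots> = 16 * (25 / 32) ^ j" using power_divide[of "25 / 16 :: real" 2 j] by simp
  finally show "norm ((real (j + 1))\<^sup>2 / 2 ^ j) \<le> 16 * (25 / 32) ^ j" by simp
qed

lemma influence_tail_pos: "influence_tail n > 0"
  unfolding influence_tail_def
  using summable_ignore_initial_segment[OF summable_influence, of n]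
  by (intro suminf_pos) (auto simp: add_ac)

lemma influence_tail_small:
  assumes "e > 0"
  obtains n where "influence_tail (Suc n) < e"
proof -
  obtain N where N: "\<And>n. n \<ge> N \<Longrightarrow> norm (\<Sum>i. (real (i + n + 1))\<^sup>2 / 2 ^ (i + n)) < e"
    using suminf_exist_split[OF assms summable_influence] by auto
  then show thesis using that[of N] N[of "Suc N"] unfolding influence_tail_def by force
qed

lemma sum_influence_le: "(\<Sum>d=n..m. (real (d + 1))\<^sup>2 / 2 ^ d) \<le> influence_tail n"
proof -
  have "(\<Sum>d=n..m. (real (d + 1))\<^sup>2 / 2 ^ d) \<le> (\<Sum>i\<in>{..m}. (real (i + n + 1))\<^sup>2 / 2 ^ (i + n))"
  proof -
    have "(\<Sum>d=n..m. (real (d + 1))\<^sup>2 / 2 ^ d) = (\<Sum>i\<in>(\<lambda>d. d - n) ` {n..m}. (real (i + n + 1))\<^sup>2 / 2 ^ (i + n))"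
      by (subst sum.reindex) (auto simp: inj_on_def)
    also have "\<dots> \<le> (\<Sum>i\<in>{..m}. (real (i + n + 1))\<^sup>2 / 2 ^ (i + n))"
      by (intro sum_mono2) auto
    finally show ?thesis .
  qed
  also have "\<dots> \<le> influence_tail n"
    unfolding influence_tail_def
    using summable_ignore_initial_segment[OF summable_influence, of n]
    by (intro sum_le_suminf) (auto simp: add_ac)
  finally show ?thesis .
qed

lemma sum_influence_squared:
  assumes "J \<le> m"
  shows "(\<Sum>u\<in>complete_binary_tree m - complete_binary_tree J. (influence u)\<^sup>2) \<le> influence_tail (Suc J)"
    and "(\<Sum>u\<in>complete_binary_tree m. (influence u)\<^sup>2) \<le> influence_tail 0"
proof -
  have sq: "(influence u)\<^sup>2 = (real (length u + 1))\<^sup>2 / 4 ^ length u" for u :: "bool list"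
  proof -
    have "(2 ^ length u)\<^sup>2 = (4 :: real) ^ length u"
      by (simp add: power2_eq_square flip: power_mult_distrib)
    then show ?thesis by (simp add: influence_def power_divide)
  qed
  have lev: "2 ^ d * (c / 4 ^ d) = c / (2 :: real) ^ d" for c d
    by (simp add: field_simps) (simp flip: power_mult_distrib)
  show "(\<Sum>u\<in>complete_binary_tree m. (influence u)\<^sup>2) \<le> influence_tail 0"
    unfolding sq using sum_complete_binary_tree[of "\<lambda>d. (real (d + 1))\<^sup>2 / 4 ^ d" m]
      sum_influence_le[of 0 m] lev by (simp add: atMost_atLeast0)
  have "(\<Sum>u\<in>complete_binary_tree m - complete_binary_tree J. (influence u)\<^sup>2) =
      (\<Sum>u\<in>complete_binary_tree m. if J < length u then (real (length u + 1))\<^sup>2 / 4 ^ length u else 0)"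
    unfolding sq using finite_complete_binary_tree[of m]
    by (intro sum.mono_neutral_cong_left) (auto simp: complete_binary_tree_def)
  also have "\<dots> = (\<Sum>d\<le>m. 2 ^ d * (if J < d then (real (d + 1))\<^sup>2 / 4 ^ d else 0))"
    by (rule sum_complete_binary_tree)
  also have "\<dots> = (\<Sum>d=Suc J..m. (real (d + 1))\<^sup>2 / 2 ^ d)"
    using lev by (intro sum.mono_neutral_cong_right) auto
  also have "\<dots> \<le> influence_tail (Suc J)" by (rule sum_influence_le)
  finally show "(\<Sum>u\<in>complete_binary_tree m - complete_binary_tree J. (influence u)\<^sup>2) \<le> influence_tail (Suc J)" .
qed

lemma occurrences_bounds:
  assumes "finite C"
  shows "0 \<le> occurrences \<alpha> C w" "occurrences \<alpha> C w \<le> real (card C)"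
proof -
  show "0 \<le> occurrences \<alpha> C w" unfolding occurrences_def by (simp add: sum_nonneg)
  have "occurrences \<alpha> C w \<le> (\<Sum>us\<in>C. 1)" unfolding occurrences_def by (intro sum_mono) auto
  then show "occurrences \<alpha> C w \<le> real (card C)" by simp
qed

text \<open>Only the members of \<open>C\<close> containing \<open>u\<close> can change status. Both
  partial counts lie between 0 and their number, so the difference is at most that number, not twice
  it.\<close>

lemma occurrences_update:
  assumes C: "finite C"
  shows "\<bar>occurrences \<alpha> C (w(u := z)) - occurrences \<alpha> C w\<bar> \<le> real (card {us \<in> C. u \<in> set us})"
proof -
  have split: "occurrences \<alpha> C \<eta> =
      occurrences \<alpha> {us \<in> C. u \<in> set us} \<eta> + occurrences \<alpha> {us \<in> C. u \<notin> set us} \<eta>" for \<eta>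
  proof -
    have "occurrences \<alpha> C \<eta> = (\<Sum>us\<in>{us \<in> C. u \<in> set us} \<union> {us \<in> C. u \<notin> set us}.
        of_bool (same_order (map \<eta> us) \<alpha>))"
      unfolding occurrences_def by (rule sum.cong) auto
    also have "\<dots> = occurrences \<alpha> {us \<in> C. u \<in> set us} \<eta> + occurrences \<alpha> {us \<in> C. u \<notin> set us} \<eta>"
      unfolding occurrences_def by (rule sum.union_disjoint) (use C in auto)
    finally show ?thesis .
  qed
  have "occurrences \<alpha> {us \<in> C. u \<notin> set us} (w(u := z)) = occurrences \<alpha> {us \<in> C. u \<notin> set us} w"
    by (rule occurrences_cong) auto
  then show ?thesis
    using split[of "w(u := z)"] split[of w] C
      occurrences_bounds[of "{us \<in> C. u \<in> set us}" \<alpha> "w(u := z)"]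
      occurrences_bounds[of "{us \<in> C. u \<in> set us}" \<alpha> w] by auto
qed

section \<open>The normalised count, its top approximation, and moment bounds uniform in the
  height\<close>

locale pattern =
  fixes \<alpha> :: "nat list"
  assumes long: "length \<alpha> \<ge> 2"
begin

abbreviation k :: nat where "k \<equiv> length \<alpha>"

abbreviation tree :: "nat \<Rightarrow> bool list set" where "tree \<equiv> complete_binary_tree"

definition scaled_count :: "nat \<Rightarrow> (bool list \<Rightarrow> real) \<Rightarrow> real" where
  "scaled_count m w = occurrences \<alpha> (chains k (tree m)) w / level_sum (k - 2) m"

definition mean :: "nat \<Rightarrow> real" where
  "mean m = integral\<^sup>L (iid (tree m)) (scaled_count m)"

text \<open>Chains that leave the top levels right after \<open>u\<close>. Given the top labels,
  their pattern probability depends on the label of \<open>u\<close> alone.\<close>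

definition jump :: "nat \<Rightarrow> nat \<Rightarrow> bool list \<Rightarrow> bool list list set" where
  "jump J m u = {us \<in> chains k (tree m). hd us = u \<and> set (tl us) \<inter> tree J = {}}"

definition stay :: "nat \<Rightarrow> nat \<Rightarrow> bool list \<Rightarrow> bool list list set" where
  "stay J m u = {us \<in> chains k (tree m). hd us = u \<and> set (tl us) \<inter> tree J \<noteq> {}}"

text \<open>In each node \<open>u\<close> of the top part, the proportion of chains lost by
  demanding an immediate jump is at most the bracket, relative to \<open>1 / 2 ^ length u\<close>.
  Each of the \<open>J + 1\<close> top levels adds these weights up to 1, whence the factor.\<close>

definition defect :: "nat \<Rightarrow> nat \<Rightarrow> real" where
  "defect J m = real (J + 1) * (1 - 2 ^ (J + 1) * level_sum (k - 2) (m - (J + 1)) / level_sum (k - 2) m)"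

text \<open>Stated for abstract positions \<open>0..<k\<close>, with position 0 carrying the label
  \<open>t\<close>, so that it is the same function for all chains and all trees.\<close>

definition top_prob :: "real \<Rightarrow> real" where
  "top_prob t = (\<integral>z. occurrences \<alpha> {[0..<k]} (z(0 := t)) \<partial>iid {1..<k})"

definition top_centred :: "real \<Rightarrow> real" where
  "top_centred t = top_prob t - integral\<^sup>L unif top_prob"

definition top_sum :: "nat \<Rightarrow> (bool list \<Rightarrow> real) \<Rightarrow> real" where
  "top_sum J w = (\<Sum>u\<in>tree J. top_centred (w u) / 2 ^ length u)"

lemma finite_chains_tree [simp]: "finite (chains k (tree m))"
  by (simp add: finite_chains)

lemma tree_mono: "J \<le> m \<Longrightarrow> tree J \<subseteq> tree m"
  by (auto simp: complete_binary_tree_def)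

lemma chains_subset: "us \<in> chains k (tree m) \<Longrightarrow> set us \<subseteq> tree m"
  by (simp add: chains_def)

lemma scaled_count_measurable [measurable]: "scaled_count m \<in> borel_measurable (iid (tree m))"
  unfolding scaled_count_def[abs_def]
  by (intro borel_measurable_divide borel_measurable_const occurrences_measurable chains_subset)

lemma scaled_count_bounded: "\<bar>scaled_count m w\<bar> \<le> real (card (chains k (tree m))) / level_sum (k - 2) m"
  using occurrences_bounds[OF finite_chains_tree, of \<alpha> m w] level_sum_nonneg[of "k - 2" m]
  by (simp add: scaled_count_def divide_right_mono)

lemma scaled_count_update:
  assumes m: "m \<ge> k - 2" and u: "u \<in> tree m"
  shows "\<bar>scaled_count m (w(u := z)) - scaled_count m w\<bar> \<le> influence u"
proof -
  have s: "level_sum (k - 2) m > 0" using m by (rule level_sum_pos)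
  have "\<bar>occurrences \<alpha> (chains k (tree m)) (w(u := z)) - occurrences \<alpha> (chains k (tree m)) w\<bar>
      \<le> real (length u + 1) * (level_sum (k - 2) m / 2 ^ length u)"
    using occurrences_update[OF finite_chains_tree] card_chains_through[OF u long] by (rule order_trans)
  also have "\<dots> = influence u * level_sum (k - 2) m" by (simp add: influence_def)
  finally show ?thesis
    using s by (simp add: scaled_count_def diff_divide_distrib[symmetric] divide_le_eq)
qed

text \<open>The bounded difference bound with variance proxy \<open>influence_tail 0\<close>. It
  does not depend on \<open>m\<close>, and it serves both the normalised count and its top
  approximation.\<close>

definition moment_bound :: "nat \<Rightarrow> real" where
  "moment_bound p = 2 * fact p * exp (1 / 2) * sqrt (influence_tail 0) ^ p"

lemma scaled_count_moment:
  assumes m: "m \<ge> k - 2"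
  shows "(\<integral>w. \<bar>scaled_count m w - mean m\<bar> ^ p \<partial>iid (tree m)) \<le> moment_bound p"
proof -
  interpret product_prob_space "\<lambda>_. unif" by (rule product_prob_space_unif)
  show ?thesis
    unfolding mean_def moment_bound_def
  proof (rule bounded_differences_moment)
    show "(\<Sum>u\<in>tree m. (influence u)\<^sup>2) \<le> (sqrt (influence_tail 0))\<^sup>2"
      using sum_influence_squared(2)[of 0 m] influence_tail_pos[of 0] by simp
  qed (use scaled_count_bounded scaled_count_update[OF m] influence_tail_pos in auto)
qed

lemma chain_word_measurable: "occurrences \<alpha> {[0..<k]} \<in> borel_measurable (iid (insert 0 {1..<k}))"
  using long by (intro occurrences_measurable) auto

lemma top_prob_bounds: "0 \<le> top_prob t" "top_prob t \<le> 1"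
  and top_prob_measurable [measurable]: "top_prob \<in> borel_measurable unif"
proof -
  interpret product_prob_space "\<lambda>_::nat. unif" by (rule product_prob_space_unif)
  interpret Q: prob_space "iid {1..<k}" by (rule prob_space_iid)
  have *: "(\<lambda>(z, t). occurrences \<alpha> {[0..<k]} (z(0 := t))) \<in> borel_measurable (iid {1..<k} \<Otimes>\<^sub>M unif)"
    using measurable_comp[OF measurable_add_dim[of 0 "{1..<k}" "\<lambda>_. unif"] chain_word_measurable]
    by (simp add: comp_def case_prod_beta)
  have bd: "0 \<le> occurrences \<alpha> {[0..<k]} z" "occurrences \<alpha> {[0..<k]} z \<le> 1" for z :: "nat \<Rightarrow> real"
    using occurrences_bounds[of "{[0..<k]}" \<alpha> z] by auto
  show "0 \<le> top_prob t" unfolding top_prob_def by (intro integral_nonneg_AE AE_I2 bd)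
  have "(\<lambda>z. occurrences \<alpha> {[0..<k]} (z(0 := t))) \<in> borel_measurable (iid {1..<k})"
    using measurable_Pair1[OF *, of t] by simp
  then show "top_prob t \<le> 1"
    unfolding top_prob_def
    using Q.integral_le_const[OF Q.integrable_const_bound[where B = 1]] bd by auto
  have "(\<lambda>(t, z). occurrences \<alpha> {[0..<k]} (z(0 := t))) \<in> borel_measurable (unif \<Otimes>\<^sub>M iid {1..<k})"
    using * by (subst measurable_pair_swap_iff) (simp add: case_prod_beta)
  then show "top_prob \<in> borel_measurable unif"
    unfolding top_prob_def[abs_def] by (rule Q.borel_measurable_lebesgue_integral)
qed

lemma top_centred_measurable [measurable]: "top_centred \<in> borel_measurable unif"
  unfolding top_centred_def[abs_def] by measurable

lemma top_centred_integral: "integral\<^sup>L unif top_centred = 0"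
proof -
  interpret prob_space unif by (rule prob_space_unif)
  have "integrable unif top_prob"
    using top_prob_bounds by (intro integrable_const_bound[where B = 1] AE_I2) auto
  then show ?thesis unfolding top_centred_def[abs_def] by (simp add: prob_space[simplified])
qed

lemma top_centred_bound: "\<bar>top_centred t\<bar> \<le> 1"
proof -
  interpret prob_space unif by (rule prob_space_unif)
  have int: "integrable unif top_prob"
    using top_prob_bounds by (intro integrable_const_bound[where B = 1] AE_I2) auto
  have "0 \<le> integral\<^sup>L unif top_prob" "integral\<^sup>L unif top_prob \<le> 1"
    using integral_ge_const[OF int, of 0] integral_le_const[OF int, of 1] top_prob_bounds by auto
  then show ?thesis
    using top_prob_bounds[of t] unfolding top_centred_def by auto
qed

lemma integral_iid_component:
  assumes u: "u \<in> T" and f: "f \<in> borel_measurable unif"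
  shows "(\<integral>w. f (w u) \<partial>iid T) = (integral\<^sup>L unif f :: real)"
proof -
  have "integral\<^sup>L unif f = integral\<^sup>L (distr (iid T) unif (\<lambda>w. w u)) f"
    using distr_PiM_component[of T "\<lambda>_. unif" u] prob_space_unif u by simp
  also have "\<dots> = (\<integral>w. f (w u) \<partial>iid T)"
    using u f by (intro integral_distr measurable_component_singleton) auto
  finally show ?thesis by simp
qed

lemma top_centred_component_measurable:
  "u \<in> T \<Longrightarrow> (\<lambda>w. top_centred (w u)) \<in> borel_measurable (iid T)"
  by (rule measurable_compose[OF measurable_component_singleton[where M = "\<lambda>_. unif"] top_centred_measurable])

lemma top_sum_measurable:
  assumes "J \<le> m"
  shows "top_sum J \<in> borel_measurable (iid (tree m))"
  unfolding top_sum_def[abs_def] using tree_mono[OF assms]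
  by (intro borel_measurable_sum borel_measurable_divide borel_measurable_const
      top_centred_component_measurable) auto

lemma top_sum_bounded: "\<bar>top_sum J w\<bar> \<le> real (card (tree J))"
proof -
  have "\<bar>top_sum J w\<bar> \<le> (\<Sum>u\<in>tree J. 1)"
    unfolding top_sum_def
  proof (rule order_trans[OF sum_abs sum_mono])
    fix u :: "bool list"
    show "\<bar>top_centred (w u) / 2 ^ length u\<bar> \<le> 1"
      using top_centred_bound[of "w u"] one_le_power[of "2 :: real" "length u"]
      by (simp add: divide_le_eq del: one_le_power)
  qed
  then show ?thesis by simp
qed

text \<open>The sum has mean 0 because each term is centred. One label changes it by at most
  \<open>1 / 2 ^ length u\<close>, which is weakened to \<open>influence u\<close> so that the bound
  for the count applies verbatim, uniformly also in \<open>J\<close>.\<close>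

lemma top_sum_moment:
  assumes J: "J \<le> m"
  shows "(\<integral>w. \<bar>top_sum J w\<bar> ^ p \<partial>iid (tree m)) \<le> moment_bound p"
proof -
  interpret product_prob_space "\<lambda>_::bool list. unif" by (rule product_prob_space_unif)
  interpret Q: prob_space "iid (tree m)" by (rule prob_space_iid)
  have "integral\<^sup>L (iid (tree m)) (top_sum J) =
      (\<Sum>u\<in>tree J. (\<integral>w. top_centred (w u) / 2 ^ length u \<partial>iid (tree m)))"
    unfolding top_sum_def
  proof (rule Bochner_Integration.integral_sum)
    fix u assume "u \<in> tree J"
    then have "(\<lambda>w. top_centred (w u)) \<in> borel_measurable (iid (tree m))"
      using tree_mono[OF J] by (intro top_centred_component_measurable) auto
    then show "integrable (iid (tree m)) (\<lambda>w. top_centred (w u) / 2 ^ length u)"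
      using top_centred_bound
      by (intro integrable_divide Q.integrable_const_bound[where B = 1] AE_I2) auto
  qed
  also have "\<dots> = 0"
  proof (intro sum.neutral ballI)
    fix u assume "u \<in> tree J"
    then have "u \<in> tree m" using tree_mono[OF J] by auto
    from integral_iid_component[OF this top_centred_measurable]
    show "(\<integral>w. top_centred (w u) / 2 ^ length u \<partial>iid (tree m)) = 0"
      by (simp add: top_centred_integral)
  qed
  finally have mean0: "integral\<^sup>L (iid (tree m)) (top_sum J) = 0" .
  have upd: "\<bar>top_sum J (w(u := z)) - top_sum J w\<bar> \<le> influence u" for w u z
  proof (cases "u \<in> tree J")
    case True
    have "top_sum J \<eta> = top_centred (\<eta> u) / 2 ^ length u + (\<Sum>v\<in>tree J - {u}. top_centred (\<eta> v) / 2 ^ length v)" for \<eta>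
      unfolding top_sum_def using True by (intro sum.remove) auto
    then have "top_sum J (w(u := z)) - top_sum J w = (top_prob z - top_prob (w u)) / 2 ^ length u"
      by (simp add: top_centred_def diff_divide_distrib)
    moreover have "\<bar>top_prob z - top_prob (w u)\<bar> \<le> real (length u + 1)"
      using top_prob_bounds[of z] top_prob_bounds[of "w u"] by auto
    ultimately show ?thesis by (simp add: influence_def divide_right_mono)
  next
    case False
    then have "top_sum J (w(u := z)) = top_sum J w"
      unfolding top_sum_def by (intro sum.cong) auto
    then show ?thesis by (simp add: influence_def)
  qed
  have "(\<integral>w. \<bar>top_sum J w - integral\<^sup>L (iid (tree m)) (top_sum J)\<bar> ^ p \<partial>iid (tree m)) \<le> moment_bound p"
    unfolding moment_bound_def
  proof (rule bounded_differences_moment)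
    show "(\<Sum>u\<in>tree m. (influence u)\<^sup>2) \<le> (sqrt (influence_tail 0))\<^sup>2"
      using sum_influence_squared(2)[of 0 m] influence_tail_pos[of 0] by simp
  qed (use top_sum_measurable[OF J] top_sum_bounded upd influence_tail_pos in auto)
  then show ?thesis unfolding mean0 by simp
qed

text \<open>The marginal of the independent labels on the top nodes is again independent and
  uniform, so the right side no longer mentions \<open>m\<close>. The Cauchy argument relies on
  this.\<close>

lemma top_sum_moment_eq:
  assumes J: "J \<le> m"
  shows "(\<integral>w. top_sum J w ^ r \<partial>iid (tree m)) = (\<integral>w. top_sum J w ^ r \<partial>iid (tree J))"
proof -
  have meas: "(\<lambda>w. restrict w (tree J)) \<in> measurable (iid (tree m)) (iid (tree J))"
    by (rule measurable_restrict_subset[OF tree_mono[OF J]])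
  have "distr (iid (tree m)) (iid (tree J)) (\<lambda>w. restrict w (tree J)) = iid (tree J)"
    by (rule distr_PiM_reindex[of "tree m" "\<lambda>_. unif" "\<lambda>u. u" "tree J"])
      (use tree_mono[OF J] prob_space_unif in auto)
  then have "(\<integral>w. top_sum J w ^ r \<partial>iid (tree J)) =
      (\<integral>w. top_sum J w ^ r \<partial>distr (iid (tree m)) (iid (tree J)) (\<lambda>w. restrict w (tree J)))"
    by simp
  also have "\<dots> = (\<integral>w. top_sum J (restrict w (tree J)) ^ r \<partial>iid (tree m))"
    using meas top_sum_measurable[of J J] by (intro integral_distr) auto
  also have "\<dots> = (\<integral>w. top_sum J w ^ r \<partial>iid (tree m))"
    by (simp add: top_sum_def)
  finally show ?thesis by simp
qed

end

lemma chain_head: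
  assumes us: "us \<in> chains n T" and n: "n \<ge> 1"
  shows "us \<noteq> []" "length us = n" "hd us \<in> T" "set (tl us) \<subseteq> T" "distinct us"
    "\<And>w. w \<in> set (tl us) \<Longrightarrow> strict_prefix (hd us) w"
proof -
  show ne: "us \<noteq> []" "length us = n" using us n by (auto simp: chains_def)
  obtain v vs where v: "us = v # vs" using ne by (cases us) auto
  show "hd us \<in> T" "set (tl us) \<subseteq> T" "\<And>w. w \<in> set (tl us) \<Longrightarrow> strict_prefix (hd us) w"
    using us v by (auto simp: chains_def)
  have "sorted_wrt strict_prefix us" using us by (simp add: chains_def)
  then have "sorted_wrt (<) (map length us)"
    unfolding sorted_wrt_map by (rule sorted_wrt_mono_rel[rotated]) (rule prefix_length_less)
  then show "distinct us" by (simp add: strict_sorted_iff distinct_map)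
qed

context pattern
begin

lemma occurrences_singleton: "occurrences \<alpha> {us} w = of_bool (same_order (map w us) \<alpha>)"
  by (simp add: occurrences_def del: sum_of_bool_eq)

text \<open>With the label of the head fixed, the other labels sit at distinct nodes of
  \<open>S\<close>, hence are independent and uniform; reindexing them by their positions in the
  chain gives the integral defining \<open>top_prob\<close>.\<close>

lemma integral_jumping_chain:
  assumes us: "length us = k" "distinct us" "hd us \<in> I" "set (tl us) \<subseteq> S" and IS: "I \<inter> S = {}"
  shows "(\<integral>y. of_bool (same_order (map (merge I S (x, y)) us) \<alpha>) \<partial>iid S) = top_prob (x (hd us))"
proof -
  define G where "G = (\<lambda>z. occurrences \<alpha> {[0..<k]} (z(0 := x (hd us))))"
  define sh where "sh = (\<lambda>y :: 'a \<Rightarrow> real. \<lambda>i\<in>{1..<k}. y (us ! i))"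
  have ne: "us \<noteq> []" using us(1) long by auto
  have in_S: "us ! i \<in> S" if "i \<in> {1..<k}" for i
  proof -
    have "us ! i = tl us ! (i - 1)" "i - 1 < length (tl us)" using that us(1) ne by (auto simp: nth_tl)
    then show ?thesis using us(4) by auto
  qed
  have "(\<lambda>z. z(0 := x (hd us))) \<in> measurable (iid {1..<k}) (iid (insert 0 {1..<k}))"
    by (rule measurable_fun_upd[where J = "{1..<k}"]) auto
  from measurable_compose[OF this chain_word_measurable]
  have G: "G \<in> borel_measurable (iid {1..<k})" by (simp add: G_def)
  have sh: "sh \<in> measurable (iid S) (iid {1..<k})"
    unfolding sh_def by (intro measurable_restrict measurable_component_singleton in_S)
  have "inj_on (\<lambda>i. us ! i) {1..<k}" using us(1,2) by (auto simp: inj_on_def nth_eq_iff_index_eq)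
  then have "distr (iid S) (iid {1..<k}) sh = iid {1..<k}"
    unfolding sh_def using in_S prob_space_unif
    by (intro distr_PiM_reindex[of S "\<lambda>_. unif" "\<lambda>i. us ! i" "{1..<k}"]) auto
  then have "top_prob (x (hd us)) = integral\<^sup>L (distr (iid S) (iid {1..<k}) sh) G"
    unfolding top_prob_def G_def by simp
  also have "\<dots> = (\<integral>y. G (sh y) \<partial>iid S)" by (rule integral_distr[OF sh G])
  also have "\<dots> = (\<integral>y. of_bool (same_order (map (merge I S (x, y)) us) \<alpha>) \<partial>iid S)"
  proof (intro Bochner_Integration.integral_cong refl)
    fix y
    have "map ((sh y)(0 := x (hd us))) [0..<k] = map (merge I S (x, y)) us"
    proof (rule nth_equalityI)
      fix i assume i: "i < length (map ((sh y)(0 := x (hd us))) [0..<k])"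
      show "map ((sh y)(0 := x (hd us))) [0..<k] ! i = map (merge I S (x, y)) us ! i"
      proof (cases "i = 0")
        case True
        then show ?thesis using i us(1,3) ne by (simp add: hd_conv_nth merge_def)
      next
        case False
        then have "us ! i \<in> S" using i in_S by auto
        then show ?thesis using False i us(1) IS by (auto simp: sh_def merge_def)
      qed
    qed (use us(1) in simp)
    then show "G (sh y) = of_bool (same_order (map (merge I S (x, y)) us) \<alpha>)"
      by (simp add: G_def occurrences_singleton)
  qed
  finally show ?thesis by simp
qed

section \<open>Conditioning on the labels of the top levels\<close>

abbreviation rest :: "nat \<Rightarrow> nat \<Rightarrow> bool list set" where "rest J m \<equiv> tree m - tree J"

text \<open>The conditional expectation given the top labels \<open>x\<close>. For a product measure
  it is simply a partial integral, with \<open>merge\<close> gluing the two families of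
  labels.\<close>

definition cond_mean :: "nat \<Rightarrow> nat \<Rightarrow> (bool list \<Rightarrow> real) \<Rightarrow> real" where
  "cond_mean J m x = (\<integral>y. scaled_count m (merge (tree J) (rest J m) (x, y)) \<partial>iid (rest J m))"

lemma tree_Un_rest: "J \<le> m \<Longrightarrow> tree J \<union> rest J m = tree m"
  using tree_mono[of J m] by auto

lemma merge_rest_measurable:
  assumes J: "J \<le> m" and x: "x \<in> space (iid (tree J))"
  shows "(\<lambda>y. merge (tree J) (rest J m) (x, y)) \<in> measurable (iid (rest J m)) (iid (tree m))"
proof -
  have "(\<lambda>y. merge (tree J) (rest J m) (x, y)) \<in>
      measurable (iid (rest J m)) (iid (tree J \<union> rest J m))"
    by (rule measurable_compose[OF measurable_Pair1'[OF x] measurable_merge])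
  then show ?thesis unfolding tree_Un_rest[OF J] .
qed

lemma chains_partition:
  assumes J: "J \<le> m"
  shows "chains k (tree m) = {us \<in> chains k (tree m). hd us \<notin> tree J} \<union>
    (\<Union>u\<in>tree J. jump J m u \<union> stay J m u)"
  by (auto simp: jump_def stay_def)

lemma chain_avoids:
  assumes us: "us \<in> chains k (tree m)" and hd: "hd us \<notin> tree J"
  shows "set us \<subseteq> rest J m"
proof -
  have k: "k \<ge> 1" using long by simp
  have "w \<notin> tree J" if "w \<in> set us" for w
  proof (cases "w = hd us")
    case False
    then have "w \<in> set (tl us)" using that chain_head(1)[OF us k] by (cases us) auto
    from prefix_length_less[OF chain_head(6)[OF us k this]] hd
    show ?thesis by (simp add: complete_binary_tree_def)
  qed (use hd in simp)
  then show ?thesis using chains_subset[OF us] by auto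
qed

text \<open>Chains starting outside the top part never enter it and contribute a constant
  \<open>c\<close>; jumping chains contribute exactly \<open>top_prob\<close> of their first label;
  each staying chain contributes something in the unit interval. It matters that \<open>c\<close> is
  independent of \<open>x\<close>: it cancels when the mean is subtracted.\<close>

lemma cond_mean_bounds:
  assumes J: "J \<le> m" and m: "m \<ge> k - 2"
  obtains c where "\<And>x. x \<in> space (iid (tree J)) \<Longrightarrow>
      level_sum (k - 2) m * cond_mean J m x - (\<Sum>u\<in>tree J. real (card (jump J m u)) * top_prob (x u))
        \<in> {c..c + (\<Sum>u\<in>tree J. real (card (stay J m u)))}"
proof -
  define S where "S = rest J m"
  define C0 where "C0 = {us \<in> chains k (tree m). hd us \<notin> tree J}"
  define q where "q = (\<lambda>x us. \<integral>y. of_bool (same_order (map (merge (tree J) S (x, y)) us) \<alpha>) \<partial>iid S :: real)"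
  define c where "c = (\<Sum>us\<in>C0. \<integral>y. of_bool (same_order (map y us) \<alpha>) \<partial>iid S :: real)"
  interpret S: prob_space "iid S" by (rule prob_space_iid)
  have k: "k \<ge> 1" using long by simp
  have s: "level_sum (k - 2) m > 0" using m by (rule level_sum_pos)
  have fin: "finite (jump J m u)" "finite (stay J m u)" "finite C0" for u
    by (auto simp: jump_def stay_def C0_def)
  have "level_sum (k - 2) m * cond_mean J m x - (\<Sum>u\<in>tree J. real (card (jump J m u)) * top_prob (x u))
        \<in> {c..c + (\<Sum>u\<in>tree J. real (card (stay J m u)))}" if x: "x \<in> space (iid (tree J))" for x
  proof -
    have int: "integrable (iid S) (\<lambda>y. of_bool (same_order (map (merge (tree J) S (x, y)) us) \<alpha>) :: real)"
      if us: "us \<in> chains k (tree m)" for us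
    proof (rule S.integrable_const_bound[where B = 1])
      have "occurrences \<alpha> {us} \<in> borel_measurable (iid (tree m))"
        using chains_subset[OF us] by (intro occurrences_measurable) auto
      from measurable_compose[OF merge_rest_measurable[OF J x] this]
      show "(\<lambda>y. of_bool (same_order (map (merge (tree J) S (x, y)) us) \<alpha>) :: real) \<in> borel_measurable (iid S)"
        by (simp add: S_def occurrences_singleton)
    qed auto
    have q01: "0 \<le> q x us" "q x us \<le> 1" if "us \<in> chains k (tree m)" for us
      unfolding q_def using S.integral_le_const[OF int[OF that], of 1] by (auto intro: integral_nonneg_AE)
    have "level_sum (k - 2) m * cond_mean J m x = (\<integral>y. occurrences \<alpha> (chains k (tree m)) (merge (tree J) S (x, y)) \<partial>iid S)"
      using s by (simp add: cond_mean_def scaled_count_def S_def)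
    also have "\<dots> = (\<Sum>us\<in>chains k (tree m). q x us)"
      unfolding occurrences_def q_def by (rule Bochner_Integration.integral_sum) (rule int)
    also have "\<dots> = (\<Sum>us\<in>C0 \<union> (\<Union>u\<in>tree J. jump J m u \<union> stay J m u). q x us)"
      using chains_partition[OF J] by (simp add: C0_def)
    also have "\<dots> = (\<Sum>us\<in>C0. q x us) + (\<Sum>us\<in>(\<Union>u\<in>tree J. jump J m u \<union> stay J m u). q x us)"
      using fin by (intro sum.union_disjoint) (auto simp: C0_def jump_def stay_def)
    also have "(\<Sum>us\<in>(\<Union>u\<in>tree J. jump J m u \<union> stay J m u). q x us) = (\<Sum>u\<in>tree J. \<Sum>us\<in>jump J m u \<union> stay J m u. q x us)"
      using fin by (intro sum.UNION_disjoint) (auto simp: jump_def stay_def)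
    also have "\<dots> = (\<Sum>u\<in>tree J. (\<Sum>us\<in>jump J m u. q x us) + (\<Sum>us\<in>stay J m u. q x us))"
      using fin by (intro sum.cong refl sum.union_disjoint) (auto simp: jump_def stay_def)
    also have "\<dots> = (\<Sum>u\<in>tree J. \<Sum>us\<in>jump J m u. q x us) + (\<Sum>u\<in>tree J. \<Sum>us\<in>stay J m u. q x us)"
      by (rule sum.distrib)
    also have "(\<Sum>u\<in>tree J. \<Sum>us\<in>jump J m u. q x us) = (\<Sum>u\<in>tree J. real (card (jump J m u)) * top_prob (x u))"
    proof (rule sum.cong[OF refl])
      fix u assume u: "u \<in> tree J"
      have "q x us = top_prob (x u)" if "us \<in> jump J m u" for us
      proof -
        have us: "us \<in> chains k (tree m)" "hd us = u" "set (tl us) \<inter> tree J = {}"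
          using that by (auto simp: jump_def)
        have "q x us = top_prob (x (hd us))"
          unfolding q_def using chain_head[OF us(1) k] us u
          by (intro integral_jumping_chain) (auto simp: S_def)
        then show ?thesis using us(2) by simp
      qed
      then show "(\<Sum>us\<in>jump J m u. q x us) = real (card (jump J m u)) * top_prob (x u)" by simp
    qed
    also have "(\<Sum>us\<in>C0. q x us) = c"
      unfolding c_def q_def
    proof (intro sum.cong refl Bochner_Integration.integral_cong arg_cong[where f = of_bool] same_order_cong)
      fix us y u v assume "us \<in> C0" "u \<in> set us" "v \<in> set us"
      then have "u \<in> S" "u \<notin> tree J" "v \<in> S" "v \<notin> tree J"
        using chain_avoids[of us m J] by (auto simp: C0_def S_def)
      then show "(merge (tree J) S (x, y) u < merge (tree J) S (x, y) v) = (y u < y v)"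
        by (simp add: merge_def)
    qed
    finally have eq: "level_sum (k - 2) m * cond_mean J m x - (\<Sum>u\<in>tree J. real (card (jump J m u)) * top_prob (x u))
        = c + (\<Sum>u\<in>tree J. \<Sum>us\<in>stay J m u. q x us)" by simp
    have "(\<Sum>us\<in>stay J m u. q x us) \<le> (\<Sum>us\<in>stay J m u. 1)" "0 \<le> (\<Sum>us\<in>stay J m u. q x us)" for u
      using q01 by (intro sum_mono sum_nonneg; simp add: stay_def)+
    then have "0 \<le> (\<Sum>u\<in>tree J. \<Sum>us\<in>stay J m u. q x us)"
      "(\<Sum>u\<in>tree J. \<Sum>us\<in>stay J m u. q x us) \<le> (\<Sum>u\<in>tree J. real (card (stay J m u)))"
      by (simp_all add: sum_nonneg sum_mono)
    then show ?thesis unfolding eq by simp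
  qed
  then show thesis by (rule that)
qed

lemma scaled_count_integrable: "integrable (iid (tree m)) (scaled_count m)"
proof -
  interpret prob_space "iid (tree m)" by (rule prob_space_iid)
  show ?thesis by (rule integrable_const_bound[OF AE_I2]) (use scaled_count_bounded in auto)
qed

lemma cond_mean_measurable:
  assumes J: "J \<le> m"
  shows "cond_mean J m \<in> borel_measurable (iid (tree J))"
proof -
  interpret prob_space "iid (rest J m)" by (rule prob_space_iid)
  have "scaled_count m \<in> borel_measurable (iid (tree J \<union> rest J m))"
    unfolding tree_Un_rest[OF J] by (rule scaled_count_measurable)
  from measurable_compose[OF measurable_merge this]
  show ?thesis
    unfolding cond_mean_def[abs_def]
    by (intro borel_measurable_lebesgue_integral) (simp add: case_prod_beta)
qed

lemma cond_mean_bounded: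
  assumes J: "J \<le> m" and x: "x \<in> space (iid (tree J))"
  shows "\<bar>cond_mean J m x\<bar> \<le> real (card (chains k (tree m))) / level_sum (k - 2) m"
proof -
  interpret prob_space "iid (rest J m)" by (rule prob_space_iid)
  let ?f = "\<lambda>y. scaled_count m (merge (tree J) (rest J m) (x, y))"
  have int: "integrable (iid (rest J m)) ?f"
    using scaled_count_bounded measurable_compose[OF merge_rest_measurable[OF J x] scaled_count_measurable]
    by (intro integrable_const_bound[where B = "real (card (chains k (tree m))) / level_sum (k - 2) m"]) auto
  have "\<bar>cond_mean J m x\<bar> \<le> (\<integral>y. \<bar>?f y\<bar> \<partial>iid (rest J m))"
    unfolding cond_mean_def using integral_norm_bound[of "iid (rest J m)" ?f] by simp
  also have "\<dots> \<le> real (card (chains k (tree m))) / level_sum (k - 2) m"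
    using int by (intro integral_le_const AE_I2 scaled_count_bounded) auto
  finally show ?thesis .
qed

lemma mean_eq_cond_mean:
  assumes J: "J \<le> m"
  shows "mean m = integral\<^sup>L (iid (tree J)) (cond_mean J m)"
proof -
  interpret product_prob_space "\<lambda>_. unif" by (rule product_prob_space_unif)
  have "mean m = integral\<^sup>L (iid (tree J \<union> rest J m)) (scaled_count m)"
    unfolding mean_def tree_Un_rest[OF J] ..
  also have "\<dots> = integral\<^sup>L (iid (tree J)) (cond_mean J m)"
    unfolding cond_mean_def[abs_def]
    by (rule product_integral_fold) (unfold tree_Un_rest[OF J], auto simp: scaled_count_integrable)
  finally show ?thesis .
qed

text \<open>For each top node, jumping and staying chains together number at most
  \<open>s / 2 ^ length u\<close>, and the jumping ones alone at least \<open>\<rho>\<close> times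
  this. Both estimates are read off from this squeeze.\<close>

lemma card_jump_stay:
  assumes u: "u \<in> tree J" and J: "J < m" and m: "m \<ge> k - 2"
  defines "s \<equiv> level_sum (k - 2) m"
  defines "\<rho> \<equiv> 2 ^ (J + 1) * level_sum (k - 2) (m - (J + 1)) / s"
  shows "real (card (stay J m u)) / s \<le> (1 - \<rho>) / 2 ^ length u"
    and "\<bar>real (card (jump J m u)) / s - 1 / 2 ^ length u\<bar> \<le> (1 - \<rho>) / 2 ^ length u"
proof -
  have s: "s > 0" unfolding s_def using m by (rule level_sum_pos)
  have um: "u \<in> tree m" using u tree_mono[of J m] J by auto
  have "{us \<in> chains k (tree m). hd us = u} = jump J m u \<union> stay J m u"
    by (auto simp: jump_def stay_def)
  moreover have "card (jump J m u \<union> stay J m u) = card (jump J m u) + card (stay J m u)"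
    by (intro card_Un_disjoint) (auto simp: jump_def stay_def)
  ultimately have "real (card (jump J m u)) + real (card (stay J m u)) \<le> s / 2 ^ length u"
    using card_chains_from[OF um long] by (simp add: s_def)
  then have up: "real (card (jump J m u)) / s + real (card (stay J m u)) / s \<le> 1 / 2 ^ length u"
    using s by (simp add: field_simps)
  have "\<rho> * s / 2 ^ length u \<le> real (card (jump J m u))"
    using card_chains_jumping[OF u J long] s by (simp add: \<rho>_def jump_def)
  then have lo: "\<rho> / 2 ^ length u \<le> real (card (jump J m u)) / s"
    using s by (simp add: field_simps)
  have st: "0 \<le> real (card (stay J m u)) / s" using s by simp
  show "real (card (stay J m u)) / s \<le> (1 - \<rho>) / 2 ^ length u"
    using up lo by (simp add: diff_divide_distrib)
  show "\<bar>real (card (jump J m u)) / s - 1 / 2 ^ length u\<bar> \<le> (1 - \<rho>) / 2 ^ length u"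
    using up lo st by (simp add: diff_divide_distrib)
qed

text \<open>Two errors occur, each at most the defect: the staying chains, whose conditional
  contribution is unknown, and the replacement of the weight \<open>card (jump J m u) / s\<close> by
  \<open>1 / 2 ^ length u\<close>.\<close>

lemma cond_mean_approx:
  assumes J: "J < m" and m: "m \<ge> k - 2" and x: "x \<in> space (iid (tree J))"
  shows "\<bar>cond_mean J m x - mean m - top_sum J x\<bar> \<le> 2 * defect J m"
proof -
  define s where "s = level_sum (k - 2) m"
  define \<rho> where "\<rho> = 2 ^ (J + 1) * level_sum (k - 2) (m - (J + 1)) / s"
  define A where "A = (\<lambda>u. real (card (jump J m u)))"
  define b where "b = (\<Sum>u\<in>tree J. real (card (stay J m u)))"
  have s: "s > 0" unfolding s_def using m by (rule level_sum_pos)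
  have Jm: "J \<le> m" using J by simp
  interpret PJ: prob_space "iid (tree J)" by (rule prob_space_iid)
  have levels: "(\<Sum>u\<in>tree J. (1 - \<rho>) / 2 ^ length u) = defect J m"
    using sum_complete_binary_tree[of "\<lambda>d. (1 - \<rho>) / 2 ^ d" J]
    by (simp add: defect_def \<rho>_def s_def)
  have "b / s \<le> defect J m"
    unfolding b_def levels[symmetric] sum_divide_distrib \<rho>_def s_def
    by (intro sum_mono card_jump_stay J m)
  have "\<bar>\<Sum>u\<in>tree J. (A u / s - 1 / 2 ^ length u) * top_centred (x u)\<bar> \<le> defect J m"
  proof -
    have "\<bar>\<Sum>u\<in>tree J. (A u / s - 1 / 2 ^ length u) * top_centred (x u)\<bar> \<le> (\<Sum>u\<in>tree J. (1 - \<rho>) / 2 ^ length u)"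
    proof (rule order_trans[OF sum_abs sum_mono])
      fix u assume "u \<in> tree J"
      then have "\<bar>A u / s - 1 / 2 ^ length u\<bar> \<le> (1 - \<rho>) / 2 ^ length u"
        unfolding A_def \<rho>_def s_def by (intro card_jump_stay J m)
      then have "\<bar>A u / s - 1 / 2 ^ length u\<bar> * \<bar>top_centred (x u)\<bar> \<le> (1 - \<rho>) / 2 ^ length u * 1"
        using top_centred_bound by (intro mult_mono) auto
      then show "\<bar>(A u / s - 1 / 2 ^ length u) * top_centred (x u)\<bar> \<le> (1 - \<rho>) / 2 ^ length u"
        by (simp add: abs_mult)
    qed
    then show ?thesis unfolding levels .
  qed
  moreover have "\<bar>cond_mean J m x - mean m - (\<Sum>u\<in>tree J. A u / s * top_centred (x u))\<bar> \<le> b / s"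
  proof -
    obtain c where c: "\<And>x. x \<in> space (iid (tree J)) \<Longrightarrow>
        s * cond_mean J m x - (\<Sum>u\<in>tree J. A u * top_prob (x u)) \<in> {c..c + b}"
      using cond_mean_bounds[OF Jm m] unfolding s_def A_def b_def by blast
    define \<eta> where "\<eta> = integral\<^sup>L unif top_prob"
    have int_c: "integrable (iid (tree J)) (cond_mean J m)"
      by (rule PJ.integrable_const_bound[OF AE_I2])
        (use cond_mean_bounded[OF Jm] cond_mean_measurable[OF Jm] in auto)
    have int_t: "integrable (iid (tree J)) (\<lambda>x. top_prob (x u))" if "u \<in> tree J" for u
      using top_prob_bounds
        measurable_compose[OF measurable_component_singleton[where M = "\<lambda>_. unif", OF that] top_prob_measurable]
      by (intro PJ.integrable_const_bound[where B = 1] AE_I2) auto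
    have int_s: "integrable (iid (tree J)) (\<lambda>x. \<Sum>u\<in>tree J. A u * top_prob (x u))"
      using int_t by (intro Bochner_Integration.integrable_sum integrable_mult_right)
    have int: "integrable (iid (tree J)) (\<lambda>x. s * cond_mean J m x - (\<Sum>u\<in>tree J. A u * top_prob (x u)))"
      using int_c int_s by (intro Bochner_Integration.integrable_diff integrable_mult_right)
    have "(\<integral>x. s * cond_mean J m x - (\<Sum>u\<in>tree J. A u * top_prob (x u)) \<partial>iid (tree J)) =
        s * mean m - (\<integral>x. (\<Sum>u\<in>tree J. A u * top_prob (x u)) \<partial>iid (tree J))"
      unfolding mean_eq_cond_mean[OF Jm] using int_c int_s
      by (subst Bochner_Integration.integral_diff) auto
    also have "(\<integral>x. (\<Sum>u\<in>tree J. A u * top_prob (x u)) \<partial>iid (tree J)) = (\<Sum>u\<in>tree J. A u * \<eta>)"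
      using int_t by (subst Bochner_Integration.integral_sum)
        (auto simp: \<eta>_def integral_iid_component[OF _ top_prob_measurable])
    \<comment> \<open>Averaging over \<open>x\<close> stays within the same interval of length
      \<open>b\<close>, so a value and its mean differ by at most \<open>b\<close>, whatever
      \<open>c\<close> is.\<close>
    finally have mean: "s * mean m - (\<Sum>u\<in>tree J. A u * \<eta>) \<in> {c..c + b}"
      using PJ.integral_ge_const[OF int, of c] PJ.integral_le_const[OF int, of "c + b"] c by auto
    have "\<bar>s * cond_mean J m x - (\<Sum>u\<in>tree J. A u * top_prob (x u)) - (s * mean m - (\<Sum>u\<in>tree J. A u * \<eta>))\<bar> \<le> b"
      using c[OF x] mean by auto
    also have "s * cond_mean J m x - (\<Sum>u\<in>tree J. A u * top_prob (x u)) - (s * mean m - (\<Sum>u\<in>tree J. A u * \<eta>)) =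
        s * (cond_mean J m x - mean m - (\<Sum>u\<in>tree J. A u / s * top_centred (x u)))"
    proof -
      have "s * (\<Sum>u\<in>tree J. A u / s * top_centred (x u)) = (\<Sum>u\<in>tree J. A u * top_prob (x u)) - (\<Sum>u\<in>tree J. A u * \<eta>)"
        using s by (simp add: sum_distrib_left sum_subtractf[symmetric] top_centred_def \<eta>_def algebra_simps)
      then show ?thesis by (simp add: algebra_simps)
    qed
    finally show ?thesis using s by (simp add: abs_mult pos_le_divide_eq mult.commute)
  qed
  moreover have "cond_mean J m x - mean m - top_sum J x =
      (cond_mean J m x - mean m - (\<Sum>u\<in>tree J. A u / s * top_centred (x u)))
      + (\<Sum>u\<in>tree J. (A u / s - 1 / 2 ^ length u) * top_centred (x u))"
    by (simp add: top_sum_def left_diff_distrib sum_subtractf)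
  ultimately show ?thesis using \<open>b / s \<le> defect J m\<close> by linarith
qed

text \<open>The error splits into the fluctuation around the conditional mean and the error of the
  conditional mean itself. The first has second moment at most
  \<open>2 * fact 2 * exp (1 / 2) * influence_tail (Suc J)\<close>, since only labels below level
  \<open>J\<close> vary; the second is at most twice the defect. The inequality
  \<open>(a + b)^2 \<le> 2 * a^2 + 2 * b^2\<close> yields both factors 8.\<close>

lemma scaled_count_approx:
  assumes J: "J < m" and m: "m \<ge> k - 2"
  shows "(\<integral>w. (scaled_count m w - mean m - top_sum J w)\<^sup>2 \<partial>iid (tree m)) \<le>
    8 * exp (1 / 2) * influence_tail (Suc J) + 8 * (defect J m)\<^sup>2"
proof -
  interpret product_prob_space "\<lambda>_. unif" by (rule product_prob_space_unif)
  interpret PJ: prob_space "iid (tree J)" by (rule prob_space_iid)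
  interpret S: prob_space "iid (rest J m)" by (rule prob_space_iid)
  interpret Q: prob_space "iid (tree m)" by (rule prob_space_iid)
  have Jm: "J \<le> m" using J by simp
  define B where "B = real (card (chains k (tree m))) / level_sum (k - 2) m"
  define f where "f = (\<lambda>w. (scaled_count m w - mean m - top_sum J w)\<^sup>2)"
  have f_meas: "f \<in> borel_measurable (iid (tree m))"
    using top_sum_measurable[OF Jm] unfolding f_def by measurable
  define D where "D = (B + \<bar>mean m\<bar> + real (card (tree J)))\<^sup>2"
  have f_bound: "norm (f w) \<le> D" for w
  proof -
    have "\<bar>scaled_count m w - mean m - top_sum J w\<bar> \<le> B + \<bar>mean m\<bar> + real (card (tree J))"
      using scaled_count_bounded[of m w] top_sum_bounded[of J w] unfolding B_def by linarith
    then have "\<bar>scaled_count m w - mean m - top_sum J w\<bar>\<^sup>2 \<le> D"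
      unfolding D_def by (intro power_mono) auto
    then show ?thesis by (simp add: f_def)
  qed
  have f_int: "integrable (iid (tree m)) f"
    using f_bound f_meas by (intro Q.integrable_const_bound[where B = D] AE_I2) auto
  have inner: "(\<integral>y. f (merge (tree J) (rest J m) (x, y)) \<partial>iid (rest J m)) \<le>
      8 * exp (1 / 2) * influence_tail (Suc J) + 8 * (defect J m)\<^sup>2" if x: "x \<in> space (iid (tree J))" for x
  proof -
    define F where "F = (\<lambda>y. scaled_count m (merge (tree J) (rest J m) (x, y)))"
    have F_meas [measurable]: "F \<in> borel_measurable (iid (rest J m))"
      unfolding F_def by (rule measurable_compose[OF merge_rest_measurable[OF Jm x] scaled_count_measurable])
    have F_bound: "\<bar>F y\<bar> \<le> B" for y
      unfolding F_def B_def by (rule scaled_count_bounded)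
    have upd: "\<bar>F (y(u := z)) - F y\<bar> \<le> influence u" if "u \<in> rest J m" for y u z
    proof -
      have "merge (tree J) (rest J m) (x, y(u := z)) = (merge (tree J) (rest J m) (x, y))(u := z)"
        using that by (auto simp: merge_def fun_eq_iff)
      then show ?thesis using that scaled_count_update[OF m, of u] by (simp add: F_def)
    qed
    have cm: "integral\<^sup>L (iid (rest J m)) F = cond_mean J m x"
      by (simp add: F_def cond_mean_def)
    have "(\<integral>y. \<bar>F y - integral\<^sup>L (iid (rest J m)) F\<bar> ^ 2 \<partial>iid (rest J m)) \<le>
        2 * fact 2 * exp (1 / 2) * sqrt (influence_tail (Suc J)) ^ 2"
    proof (rule bounded_differences_moment)
      show "(\<Sum>u\<in>rest J m. (influence u)\<^sup>2) \<le> (sqrt (influence_tail (Suc J)))\<^sup>2"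
        using sum_influence_squared(1)[OF Jm] influence_tail_pos[of "Suc J"] by simp
    qed (use F_bound upd influence_tail_pos in auto)
    then have var: "(\<integral>y. (F y - cond_mean J m x)\<^sup>2 \<partial>iid (rest J m)) \<le> 4 * exp (1 / 2) * influence_tail (Suc J)"
      using influence_tail_pos[of "Suc J"] by (simp add: cm)
    have int: "integrable (iid (rest J m)) (\<lambda>y. (F y - cond_mean J m x)\<^sup>2)"
    proof (rule S.integrable_const_bound[where B = "(B + \<bar>cond_mean J m x\<bar>)\<^sup>2"], rule AE_I2)
      fix y
      have "\<bar>F y - cond_mean J m x\<bar> \<le> B + \<bar>cond_mean J m x\<bar>" using F_bound[of y] by linarith
      then have "\<bar>F y - cond_mean J m x\<bar>\<^sup>2 \<le> (B + \<bar>cond_mean J m x\<bar>)\<^sup>2" by (intro power_mono) auto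
      then show "norm ((F y - cond_mean J m x)\<^sup>2) \<le> (B + \<bar>cond_mean J m x\<bar>)\<^sup>2" by simp
    qed measurable
    have pw: "f (merge (tree J) (rest J m) (x, y)) \<le> 2 * (F y - cond_mean J m x)\<^sup>2 + 8 * (defect J m)\<^sup>2" for y
    proof -
      define a where "a = F y - cond_mean J m x"
      define b where "b = cond_mean J m x - mean m - top_sum J x"
      have "top_sum J (merge (tree J) (rest J m) (x, y)) = top_sum J x"
        by (simp add: top_sum_def merge_def)
      then have "f (merge (tree J) (rest J m) (x, y)) = (a + b)\<^sup>2"
        by (simp add: f_def F_def a_def b_def algebra_simps)
      also have "\<dots> \<le> 2 * a\<^sup>2 + 2 * b\<^sup>2"
        using sum_squares_bound[of a b] by (simp add: power2_sum)
      also have "\<bar>b\<bar>\<^sup>2 \<le> (2 * defect J m)\<^sup>2"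
        unfolding b_def by (intro power_mono cond_mean_approx J m x) auto
      then have "b\<^sup>2 \<le> 4 * (defect J m)\<^sup>2" by (simp add: power_mult_distrib)
      finally show ?thesis by (simp add: a_def)
    qed
    have "(\<integral>y. f (merge (tree J) (rest J m) (x, y)) \<partial>iid (rest J m)) \<le>
        (\<integral>y. 2 * (F y - cond_mean J m x)\<^sup>2 + 8 * (defect J m)\<^sup>2 \<partial>iid (rest J m))"
    proof (rule integral_mono)
      show "integrable (iid (rest J m)) (\<lambda>y. f (merge (tree J) (rest J m) (x, y)))"
        using f_bound measurable_compose[OF merge_rest_measurable[OF Jm x] f_meas]
        by (intro S.integrable_const_bound[where B = D] AE_I2) auto
    qed (use int pw in auto)
    also have "\<dots> = 2 * (\<integral>y. (F y - cond_mean J m x)\<^sup>2 \<partial>iid (rest J m)) + 8 * (defect J m)\<^sup>2"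
      using int by (simp add: S.prob_space)
    finally show ?thesis using var by simp
  qed
  have "integral\<^sup>L (iid (tree m)) f = integral\<^sup>L (iid (tree J \<union> rest J m)) f"
    unfolding tree_Un_rest[OF Jm] ..
  also have "\<dots> = (\<integral>x. (\<integral>y. f (merge (tree J) (rest J m) (x, y)) \<partial>iid (rest J m)) \<partial>iid (tree J))"
    by (rule product_integral_fold) (unfold tree_Un_rest[OF Jm], auto simp: f_int)
  also have "\<dots> \<le> (\<integral>x. 8 * exp (1 / 2) * influence_tail (Suc J) + 8 * (defect J m)\<^sup>2 \<partial>iid (tree J))"
  proof (rule integral_mono_AE')
    show "AE x in iid (tree J). 0 \<le> 8 * exp (1 / 2) * influence_tail (Suc J) + 8 * (defect J m)\<^sup>2"
      using influence_tail_pos[of "Suc J"] by (intro AE_I2 add_nonneg_nonneg mult_nonneg_nonneg) auto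
  qed (use inner in auto)
  finally show ?thesis by (simp add: f_def PJ.prob_space)
qed

section \<open>Passage to the limit for moments and cumulants\<close>

lemma defect_tendsto_0: "defect J \<longlonglongrightarrow> 0"
proof -
  have "(\<lambda>m. real (J + 1) * (1 - 2 ^ (J + 1) * level_sum (k - 2) (m - (J + 1)) / level_sum (k - 2) m))
      \<longlonglongrightarrow> real (J + 1) * (1 - 1)"
    by (intro tendsto_intros level_sum_shift)
  then show ?thesis unfolding defect_def[abs_def] by simp
qed

text \<open>The order of choices matters: first \<epsilon> from the uniform moment bound
  \<open>K\<close>, then \<open>J\<close> to make the influence tail small, and only then
  \<open>m\<close> large enough for the defect of this \<open>J\<close>.\<close>

lemma scaled_count_moment_approx:
  assumes e: "e > 0"
  obtains J where "\<forall>\<^sub>F m in sequentially.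
    \<bar>(\<integral>w. (scaled_count m w - mean m) ^ r \<partial>iid (tree m)) - (\<integral>w. top_sum J w ^ r \<partial>iid (tree J))\<bar> < e"
proof -
  define K where "K = moment_bound (2 * (r - 1))"
  have K: "K \<ge> 0" by (simp add: K_def moment_bound_def influence_tail_pos less_imp_le)
  \<comment> \<open>Makes the moment part smaller than \<open>e / 2\<close>; the added 1 keeps the
    denominator positive also when \<open>r = 0\<close>.\<close>
  define \<epsilon> where "\<epsilon> = e / (2 * (real r * (2 * K) + 1))"
  have \<epsilon>: "\<epsilon> > 0" using e K by (simp add: \<epsilon>_def add_nonneg_pos)
  have small: "real r * (\<epsilon> * (2 * K)) < e / 2"
  proof -
    define c where "c = real r * (2 * K)"
    have "c \<ge> 0" using K by (simp add: c_def)
    then have "e / 2 * (c / (c + 1)) < e / 2 * 1" using e by (intro mult_strict_left_mono) auto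
    moreover have "real r * (\<epsilon> * (2 * K)) = e / 2 * (c / (c + 1))"
      unfolding \<epsilon>_def c_def[symmetric] times_divide_eq_left by (simp add: c_def mult_ac)
    ultimately show ?thesis by simp
  qed
  \<comment> \<open>The threshold for the mean square error below which
    \<open>r * V / (2 * \<epsilon>)\<close> is smaller than \<open>e / 2\<close>.\<close>
  define \<gamma> where "\<gamma> = e * \<epsilon> / (real r + 1)"
  have \<gamma>: "\<gamma> > 0" using e \<epsilon> by (simp add: \<gamma>_def)
  have \<gamma>_small: "real r * (v / (2 * \<epsilon>)) < e / 2" if "0 \<le> v" "v < \<gamma>" for v
  proof -
    have "v * (real r + 1) < e * \<epsilon>" using that \<gamma>_def by (simp add: pos_less_divide_eq)
    then have "real r * v < e * \<epsilon>" using that(1) by (simp add: algebra_simps)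
    then show ?thesis using \<epsilon> by (simp add: field_simps)
  qed
  \<comment> \<open>With the denominator \<open>16 * exp (1 / 2)\<close> the tail uses up at most
    half of \<gamma>, leaving room for the defect.\<close>
  obtain J where J: "influence_tail (Suc J) < \<gamma> / (16 * exp (1 / 2))"
    using influence_tail_small[of "\<gamma> / (16 * exp (1 / 2))"] \<gamma> by auto
  have "(\<lambda>m. 8 * exp (1 / 2) * influence_tail (Suc J) + 8 * (defect J m)\<^sup>2)
      \<longlonglongrightarrow> 8 * exp (1 / 2) * influence_tail (Suc J) + 8 * 0\<^sup>2"
    by (intro tendsto_intros defect_tendsto_0)
  moreover have "8 * exp (1 / 2) * influence_tail (Suc J) + 8 * 0\<^sup>2 < \<gamma>"
    using J \<gamma> by (simp add: pos_less_divide_eq mult_ac)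
  ultimately have "\<forall>\<^sub>F m in sequentially. 8 * exp (1 / 2) * influence_tail (Suc J) + 8 * (defect J m)\<^sup>2 < \<gamma>"
    by (rule order_tendstoD(2))
  then have "\<forall>\<^sub>F m in sequentially.
    \<bar>(\<integral>w. (scaled_count m w - mean m) ^ r \<partial>iid (tree m)) - (\<integral>w. top_sum J w ^ r \<partial>iid (tree J))\<bar> < e"
    using eventually_gt_at_top[of J] eventually_ge_at_top[of "k - 2"]
  proof eventually_elim
    case (elim m)
    interpret Q: prob_space "iid (tree m)" by (rule prob_space_iid)
    define B where "B = real (card (chains k (tree m))) / level_sum (k - 2) m + \<bar>mean m\<bar> + real (card (tree J))"
    define V where "V = (\<integral>w. (scaled_count m w - mean m - top_sum J w)\<^sup>2 \<partial>iid (tree m))"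
    define a where "a = (\<integral>w. \<bar>scaled_count m w - mean m\<bar> ^ (2 * (r - 1)) \<partial>iid (tree m))"
    define b where "b = (\<integral>w. \<bar>top_sum J w\<bar> ^ (2 * (r - 1)) \<partial>iid (tree m))"
    have V: "0 \<le> V" "V < \<gamma>"
      using scaled_count_approx[of J m] elim by (auto simp: V_def intro!: integral_nonneg_AE)
    have ab: "a \<le> K" "b \<le> K"
      unfolding a_def b_def K_def using elim by (auto intro: scaled_count_moment top_sum_moment)
    have "\<bar>(\<integral>w. (scaled_count m w - mean m) ^ r \<partial>iid (tree m)) - (\<integral>w. top_sum J w ^ r \<partial>iid (tree m))\<bar>
        \<le> real r * (V / (2 * \<epsilon>) + \<epsilon> * (a + b))"
      unfolding V_def a_def b_def
    proof (rule Q.moment_diff_le[where B = B])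
      show "top_sum J \<in> borel_measurable (iid (tree m))"
        using elim by (intro top_sum_measurable) auto
      show "\<bar>scaled_count m w - mean m\<bar> \<le> B" for w
        using scaled_count_bounded[of m w] unfolding B_def by linarith
      show "\<bar>top_sum J w\<bar> \<le> B" for w
        using top_sum_bounded[of J w] level_sum_nonneg[of "k - 2" m]
        unfolding B_def by (simp add: add_increasing)
    qed (use \<epsilon> in auto)
    also have "\<dots> = real r * (V / (2 * \<epsilon>)) + real r * (\<epsilon> * (a + b))" by (simp add: algebra_simps)
    also have "\<dots> \<le> real r * (V / (2 * \<epsilon>)) + real r * (\<epsilon> * (2 * K))"
      using ab \<epsilon> by (intro add_left_mono mult_left_mono) auto
    also have "\<dots> < e" using \<gamma>_small[OF V] small by linarith
    finally show ?case using top_sum_moment_eq[of J m r] elim by simp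
  qed
  then show thesis by (rule that)
qed

text \<open>For each tolerance, all late moments are close to one number that depends on
  \<open>J\<close> but not on \<open>m\<close>, so they form a Cauchy sequence without their limit
  being identified.\<close>

lemma convergent_scaled_count_moment:
  "convergent (\<lambda>m. \<integral>w. (scaled_count m w - mean m) ^ r \<partial>iid (tree m))"
proof -
  define E where "E = (\<lambda>m. \<integral>w. (scaled_count m w - mean m) ^ r \<partial>iid (tree m))"
  have "Cauchy E"
  proof (rule CauchyI)
    fix e :: real assume e: "e > 0"
    obtain J where "\<forall>\<^sub>F m in sequentially. \<bar>E m - (\<integral>w. top_sum J w ^ r \<partial>iid (tree J))\<bar> < e / 2"
      using scaled_count_moment_approx[of "e / 2" r] e unfolding E_def by auto
    then obtain M where M: "\<And>m. m \<ge> M \<Longrightarrow> \<bar>E m - (\<integral>w. top_sum J w ^ r \<partial>iid (tree J))\<bar> < e / 2"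
      by (auto simp: eventually_sequentially)
    have "norm (E m - E n) < e" if "m \<ge> M" "n \<ge> M" for m n
      using M[OF that(1)] M[OF that(2)] unfolding real_norm_def by linarith
    then show "\<exists>M. \<forall>m\<ge>M. \<forall>n\<ge>M. norm (E m - E n) < e" by blast
  qed
  then show ?thesis unfolding E_def by (rule real_Cauchy_convergent)
qed

lemma convergent_cumulant:
  assumes r: "r \<ge> 2"
  obtains l where "(\<lambda>m. cumulant (measure_pmf (random_labelling (tree m))) (pattern_count \<alpha> (tree m)) r
    / level_sum (k - 2) m ^ r) \<longlonglongrightarrow> l"
proof -
  \<comment> \<open>Centring uses the mean under independent labels. Any constant would do for the
    cumulants of order at least 2, but this one makes the moments those already shown to
    converge.\<close>
  define X where "X = (\<lambda>m \<pi>. occurrences \<alpha> (chains k (tree m)) (\<pi> :: bool list \<Rightarrow> nat) / level_sum (k - 2) m - mean m)"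
  have fin: "finite (set_pmf (random_labelling (tree m)))" for m
    by (simp add: random_labelling_def finite_labellings labellings_nonempty)
  have "(\<integral>\<pi>. X m \<pi> ^ n \<partial>measure_pmf (random_labelling (tree m))) =
      (\<integral>w. (scaled_count m w - mean m) ^ n \<partial>iid (tree m))" for m n
    unfolding X_def scaled_count_def
    by (rule expectation_random_labelling[where g = "\<lambda>t. (t / level_sum (k - 2) m - mean m) ^ n"])
      (auto dest: chains_subset)
  then have "convergent (\<lambda>m. cumulant (measure_pmf (random_labelling (tree m))) (X m) r)"
    using r convergent_scaled_count_moment by (intro cumulants_convergent fin) auto
  then obtain l where l: "(\<lambda>m. cumulant (measure_pmf (random_labelling (tree m))) (X m) r) \<longlonglongrightarrow> l"
    by (auto simp: convergent_def)
  have "\<forall>\<^sub>F m in sequentially. cumulant (measure_pmf (random_labelling (tree m))) (X m) r =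
      cumulant (measure_pmf (random_labelling (tree m))) (pattern_count \<alpha> (tree m)) r / level_sum (k - 2) m ^ r"
    using eventually_ge_at_top[of "k - 2"]
  proof eventually_elim
    case (elim m)
    then have s: "level_sum (k - 2) m > 0" by (rule level_sum_pos)
    then have "pattern_count \<alpha> (tree m) = (\<lambda>\<pi>. level_sum (k - 2) m * mean m + level_sum (k - 2) m * X m \<pi>)"
      by (simp add: pattern_count_eq_occurrences X_def fun_eq_iff right_diff_distrib)
    then show ?case
      using cumulant_affine[OF fin r, of m "level_sum (k - 2) m * mean m" "level_sum (k - 2) m" "X m"] s by simp
  qed
  with l have "(\<lambda>m. cumulant (measure_pmf (random_labelling (tree m))) (pattern_count \<alpha> (tree m)) r
      / level_sum (k - 2) m ^ r) \<longlonglongrightarrow> l"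
    by (rule Lim_transform_eventually)
  then show thesis by (rule that)
qed

end

theorem theorem1p3:
  fixes k r :: nat and \<alpha> :: "nat list"
  assumes "k \<ge> 2"
    and "length \<alpha> = k" and "distinct \<alpha>" and "set \<alpha> = {1..k}"
    and "r \<ge> 2"
  shows "\<exists>D::real.
    (\<lambda>m. cumulant (measure_pmf (random_labelling (complete_binary_tree m)))
             (pattern_count \<alpha> (complete_binary_tree m)) r
         - D * real (Upsilon r k (complete_binary_tree m)))
    \<in> o(\<lambda>m. real (Upsilon r k (complete_binary_tree m)))"
proof -
  interpret pattern \<alpha> by standard (use assms in simp)
  define \<kappa> where "\<kappa> = (\<lambda>m. cumulant (measure_pmf (random_labelling (complete_binary_tree m)))
    (pattern_count \<alpha> (complete_binary_tree m)) r)"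
  define \<Upsilon> where "\<Upsilon> = (\<lambda>m. real (Upsilon r k (complete_binary_tree m)))"
  define s where "s = (\<lambda>m. level_sum (k - 2) m ^ r)"
  obtain l where l: "(\<lambda>m. \<kappa> m / s m) \<longlonglongrightarrow> l"
    using convergent_cumulant[OF \<open>r \<ge> 2\<close>] assms(2) unfolding \<kappa>_def s_def by auto
  obtain c where c: "c > 0" "(\<lambda>m. \<Upsilon> m / s m) \<longlonglongrightarrow> c"
    using Upsilon_asymp[OF \<open>r \<ge> 2\<close>] unfolding \<Upsilon>_def s_def by blast
  have pos: "\<forall>\<^sub>F m in sequentially. \<Upsilon> m / s m > 0"
    using order_tendstoD(1)[OF c(2) c(1)] .
  \<comment> \<open>The constant is \<open>D = l / c\<close>. Positivity of \<open>c\<close> permits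
    the division and makes \<Upsilon> eventually nonzero.\<close>
  have "(\<lambda>m. (\<kappa> m / s m) / (\<Upsilon> m / s m) - l / c) \<longlonglongrightarrow> l / c - l / c"
    using c(1) by (intro tendsto_intros l c(2)) auto
  moreover have "\<forall>\<^sub>F m in sequentially. (\<kappa> m / s m) / (\<Upsilon> m / s m) - l / c = (\<kappa> m - l / c * \<Upsilon> m) / \<Upsilon> m"
    using pos
  proof eventually_elim
    case (elim m)
    then have "s m \<noteq> 0" "\<Upsilon> m \<noteq> 0" by auto
    then show ?case by (simp add: diff_divide_distrib)
  qed
  ultimately have "(\<lambda>m. (\<kappa> m - l / c * \<Upsilon> m) / \<Upsilon> m) \<longlonglongrightarrow> 0"
    using Lim_transform_eventually by fastforce
  then have "(\<lambda>m. \<kappa> m - l / c * \<Upsilon> m) \<in> o(\<Upsilon>)"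
    using pos by (intro smalloI_tendsto) (auto elim!: eventually_mono)
  then show ?thesis unfolding \<kappa>_def \<Upsilon>_def by blast
qed

end
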